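(* Let $U\subset \mathbb{R}^n$ be an open set and let $f:U\to \mathbb{R}$ be a (not necessarily continuous) function. Let $Q\subset \mathbb{R}^n$ be an affine 2-plane and assume that $f|_{Q'\cap U}$ is real analytic for every affine 2-plane $Q'$ near $Q$. Then $f$ is real analytic in a neighborhood of $Q\cap U$.
   Context: A subset $C\subset\mathbb{R}^n$ is a cone if $\mathbb{R}C=C$; a cone $C$ is open if $C\setminus\{0\}$ is open in $\mathbb{R}^n\setminus\{0\}$; a cone-neighborhood of a set $W$ is an open cone that contains $W$. A property $\mathcal{P}$ holds for all affine-linear subspaces near an affine-linear subspace $Q\subset\mathbb{R}^n$ if there are a choice of the origin $0\in Q$ (i.e. a point of $Q$ that is taken as the origin of $\mathbb{R}^n$, with respect to which cones are formed), a cone-neighborhood $C\supset Q$, and $\epsilon>0$ such that $\mathcal{P}$ holds for all affine-linear subspaces of the same dimension as $Q$ that are contained in $C\cup B(\epsilon)$, where $B(\epsilon)$ denotes the ball of radius $\epsilon$ centered at the chosen origin $0$. *)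

theory Defs
  imports "HOL-Analysis.Analysis"
begin

text \<open>A cone is a set \<open>C\<close> with \<open>\<real>C = C\<close>. All real factors are allowed, not only the
  nonnegative ones as in the library's \<^const>\<open>cone\<close>.\<close>

definition real_cone :: "'a::real_vector set \<Rightarrow> bool" where
  "real_cone C \<longleftrightarrow> {t *\<^sub>R x | t x. x \<in> C} = C"

definition open_cone :: "'a::real_normed_vector set \<Rightarrow> bool" where
  "open_cone C \<longleftrightarrow> real_cone C \<and> openin (top_of_set (UNIV - {0})) (C - {0})"

text \<open>\<open>holds_near Q P\<close>: the property \<open>P\<close> holds for all affine subspaces near \<open>Q\<close>. The point \<open>p\<close>
  is the chosen origin, so \<open>C\<close> is a cone after translating \<open>p\<close> to \<open>0\<close>.\<close>

definition holds_near :: "'a::euclidean_space set \<Rightarrow> ('a set \<Rightarrow> bool) \<Rightarrow> bool" where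
  "holds_near Q P \<longleftrightarrow>
     (\<exists>p\<in>Q. \<exists>C. \<exists>\<epsilon>>0. open_cone ((\<lambda>x. x - p) ` C) \<and> Q \<subseteq> C \<and>
        (\<forall>Q'. affine Q' \<and> aff_dim Q' = aff_dim Q \<and> Q' \<subseteq> C \<union> ball p \<epsilon> \<longrightarrow> P Q'))"

text \<open>Near \<open>a\<close> the function is the sum of a power series in several variables; \<open>\<alpha>\<close> ranges over
  the multi-indices. Only the values of \<open>f\<close> on some ball around \<open>a\<close> matter.\<close>

definition real_analytic_at :: "(real ^ 'n \<Rightarrow> real) \<Rightarrow> real ^ 'n \<Rightarrow> bool" where
  "real_analytic_at f a \<longleftrightarrow>
     (\<exists>c :: ('n \<Rightarrow> nat) \<Rightarrow> real. \<exists>r>0. \<forall>x\<in>ball a r.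
        ((\<lambda>\<alpha>. c \<alpha> * (\<Prod>i\<in>UNIV. (x $ i - a $ i) ^ \<alpha> i)) has_sum f x) UNIV)"

definition real_analytic_on :: "(real ^ 'n \<Rightarrow> real) \<Rightarrow> (real ^ 'n) set \<Rightarrow> bool" where
  "real_analytic_on f V \<longleftrightarrow> (\<forall>a\<in>V. real_analytic_at f a)"

text \<open>For an affine 2-plane \<open>Q\<close> and an open set \<open>U\<close>: the restriction of \<open>f\<close> to \<open>Q \<inter> U\<close> is real
  analytic, expressed in affine coordinates \<open>s \<mapsto> p + L s\<close> on \<open>Q\<close>. Two such coordinate systems
  differ by an affine automorphism of the coordinate plane, which preserves real analyticity, so
  the choice of coordinates is immaterial.\<close>

definition real_analytic_on_plane ::
    "(real ^ 'n \<Rightarrow> real) \<Rightarrow> (real ^ 'n) set \<Rightarrow> (real ^ 'n) set \<Rightarrow> bool" where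
  "real_analytic_on_plane f Q U \<longleftrightarrow>
     (\<exists>p. \<exists>L :: real ^ 2 \<Rightarrow> real ^ 'n. linear L \<and> inj L \<and> range (\<lambda>s. p + L s) = Q \<and>
        real_analytic_on (\<lambda>s. f (p + L s)) {s. p + L s \<in> U})"

end

theory Submission
  imports Defs "HOL-Complex_Analysis.Cauchy_Integral_Formula"
begin

text \<open>
  Fix \<open>a \<in> Q \<inter> U\<close> and let \<open>P\<^sub>k v\<close> be the \<open>k\<close>-th Taylor coefficient at \<open>0\<close> of \<open>t \<mapsto> f (a + t v)\<close>.
  On a plane through \<open>0\<close> near the direction of \<open>Q\<close> it is a homogeneous polynomial of degree \<open>k\<close>, so in
  suitable linear coordinates \<open>P\<^sub>k\<close> is a polynomial of degree at most \<open>k\<close> in each variable separately on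
  some box of vectors \<open>v\<close>. Hence \<open>P\<^sub>k\<close> is a polynomial there; in particular it is continuous, and by
  Baire's theorem \<open>\<bar>P\<^sub>k\<bar> \<le> M\<^sup>k\<^sup>+\<^sup>1\<close> for all \<open>k\<close> on a smaller box. Lagrange interpolation then bounds the
  coefficients of \<open>P\<^sub>k\<close> geometrically, so for a fixed small \<open>t > 0\<close> the series \<open>g v = \<Sum>\<^sub>k t\<^sup>k P\<^sub>k v\<close>
  converges as a power series on a polydisc containing both \<open>0\<close> and the box. By the identity theorem
  along rays, \<open>f (a + t v) = g v\<close> on the box, and by the identity theorem along lines joining the box
  to a neighbourhood of \<open>0\<close>, on which \<open>f\<close> is analytic as well, the equality holds near \<open>v = 0\<close>.
\<close>

subsection \<open>Analytic functions of one variable\<close>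

definition analytic_at1 :: "(real \<Rightarrow> real) \<Rightarrow> real \<Rightarrow> bool" where
  "analytic_at1 \<phi> x \<longleftrightarrow> (\<exists>c. \<exists>r>0. \<forall>h. \<bar>h\<bar> < r \<longrightarrow> (\<lambda>n. c n * h ^ n) sums \<phi> (x + h))"

lemma powser_isolated_zero:
  fixes c :: "nat \<Rightarrow> real"
  assumes r: "r > 0" and sm: "\<And>h. \<bar>h\<bar> < r \<Longrightarrow> (\<lambda>n. c n * h ^ n) sums \<phi> h" and m: "c m \<noteq> 0"
  obtains s where "s > 0" "\<And>h. 0 < \<bar>h\<bar> \<Longrightarrow> \<bar>h\<bar> \<le> s \<Longrightarrow> \<phi> h \<noteq> 0"
proof -
  \<comment> \<open>multiplying by \<open>h\<close> removes the case distinction on the constant term\<close>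
  define a where "a n = (case n of 0 \<Rightarrow> 0 | Suc k \<Rightarrow> c k)" for n
  have sm': "(\<lambda>n. a n * (h - 0) ^ n) sums (h * \<phi> h)" if "norm (h - 0) < r" for h
  proof -
    have "(\<lambda>n. h * (c n * h ^ n)) sums (h * \<phi> h)"
      using sm[of h] that by (intro sums_mult) auto
    then have "(\<lambda>n. a (Suc n) * h ^ Suc n) sums (h * \<phi> h)"
      by (simp add: a_def mult_ac)
    from sums_Suc[OF this] show ?thesis
      by (simp add: a_def)
  qed
  have "a (Suc m) \<noteq> 0" using m by (simp add: a_def)
  from powser_0_nonzero[OF r sm' _ this] obtain s where
    "0 < s" "\<And>z. z \<in> cball 0 s - {0} \<Longrightarrow> z * \<phi> z \<noteq> 0" by auto
  then show thesis by (intro that[of s]) auto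
qed

lemma powser_coeff_unique:
  fixes c d :: "nat \<Rightarrow> real"
  assumes "r > 0" "\<And>h. \<bar>h\<bar> < r \<Longrightarrow> (\<lambda>n. c n * h ^ n) sums \<phi> h"
    and "r' > 0" "\<And>h. \<bar>h\<bar> < r' \<Longrightarrow> (\<lambda>n. d n * h ^ n) sums \<phi> h"
  shows "c = d"
proof (rule ccontr)
  assume "c \<noteq> d"
  then obtain m where m: "c m - d m \<noteq> 0" by auto
  have sm: "(\<lambda>n. (c n - d n) * h ^ n) sums 0" if "\<bar>h\<bar> < min r r'" for h
    using sums_diff[OF assms(2)[of h] assms(4)[of h]] that by (simp add: algebra_simps)
  \<comment> \<open>The difference series represents the constant function 0, so the isolated-zero
    property asserts \<open>0 \<noteq> 0\<close> at \<open>h = s\<close>.\<close>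
  obtain s where s: "s > 0" "\<And>h::real. 0 < \<bar>h\<bar> \<Longrightarrow> \<bar>h\<bar> \<le> s \<Longrightarrow> (0::real) \<noteq> 0"
    using powser_isolated_zero[of "min r r'" "\<lambda>n. c n - d n" "\<lambda>_. 0"] sm m assms(1,3) by auto
  from s(2)[of s] s(1) show False by auto
qed

lemma analytic_at1_diff:
  assumes "analytic_at1 \<phi> x" "analytic_at1 \<psi> x"
  shows "analytic_at1 (\<lambda>t. \<phi> t - \<psi> t) x"
proof -
  obtain c r where c: "r > 0" "\<And>h. \<bar>h\<bar> < r \<Longrightarrow> (\<lambda>n. c n * h ^ n) sums \<phi> (x + h)"
    using assms(1) unfolding analytic_at1_def by auto
  obtain d r' where d: "r' > 0" "\<And>h. \<bar>h\<bar> < r' \<Longrightarrow> (\<lambda>n. d n * h ^ n) sums \<psi> (x + h)"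
    using assms(2) unfolding analytic_at1_def by auto
  have "(\<lambda>n. (c n - d n) * h ^ n) sums (\<phi> (x + h) - \<psi> (x + h))" if "\<bar>h\<bar> < min r r'" for h
    using sums_diff[OF c(2)[of h] d(2)[of h]] that by (simp add: algebra_simps)
  then show ?thesis
    unfolding analytic_at1_def
    by (intro exI[of _ "\<lambda>n. c n - d n"] exI[of _ "min r r'"]) (use c(1) d(1) in auto)
qed

text \<open>Dichotomy at \<open>x\<close>: if all coefficients vanish, \<delta> is zero on the whole
  interval of convergence; otherwise its zeros near \<open>x\<close> are isolated, and no
  \<open>y\<close> close to \<open>x\<close> has \<delta> vanishing on a neighbourhood. Vanishing
  near a point, not merely at it, is the property that connectedness can carry along.\<close>

lemma analytic_at1_zero_propagates:
  assumes "analytic_at1 \<delta> x"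
  obtains e where "e > 0"
    "\<And>y z. \<bar>y - x\<bar> < e \<Longrightarrow> \<bar>z - x\<bar> < e \<Longrightarrow> eventually (\<lambda>t. \<delta> t = 0) (nhds y) \<Longrightarrow>
      eventually (\<lambda>t. \<delta> t = 0) (nhds z)"
proof -
  obtain c r where c: "r > 0" "\<And>h. \<bar>h\<bar> < r \<Longrightarrow> (\<lambda>n. c n * h ^ n) sums \<delta> (x + h)"
    using assms unfolding analytic_at1_def by auto
  show thesis
  proof (cases "\<forall>m. c m = 0")
    case True
    have z: "\<delta> t = 0" if "\<bar>t - x\<bar> < r" for t
      using c(2)[of "t - x"] that True by (auto dest: sums_unique2[OF sums_zero])
    have "eventually (\<lambda>t. \<delta> t = 0) (nhds z)" if "\<bar>z - x\<bar> < r" for z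
    proof -
      have "eventually (\<lambda>t. t \<in> ball x r) (nhds z)"
        using that by (intro eventually_nhds_in_open) (auto simp: dist_real_def abs_minus_commute)
      then show ?thesis
        by (rule eventually_mono) (auto intro!: z simp: dist_real_def abs_minus_commute)
    qed
    with c(1) show thesis by (intro that[of r]) auto
  next
    case False
    then obtain m where "c m \<noteq> 0" by auto
    from powser_isolated_zero[of r c "\<lambda>h. \<delta> (x + h)", OF c this]
    obtain s where s: "s > 0" "\<And>h. 0 < \<bar>h\<bar> \<Longrightarrow> \<bar>h\<bar> \<le> s \<Longrightarrow> \<delta> (x + h) \<noteq> 0" by blast
    have "\<not> eventually (\<lambda>t. \<delta> t = 0) (nhds y)" if y: "\<bar>y - x\<bar> < s" for y
    proof
      assume "eventually (\<lambda>t. \<delta> t = 0) (nhds y)"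
      moreover have "eventually (\<lambda>t. t \<in> ball x s) (nhds y)"
        using y by (intro eventually_nhds_in_open) (auto simp: dist_real_def abs_minus_commute)
      \<comment> \<open>Close to \<open>x\<close> the only possible zero is \<open>x\<close> itself,
        yet no neighbourhood of \<open>y\<close> is a single point.\<close>
      ultimately have "eventually (\<lambda>t. t = x) (nhds y)"
      proof eventually_elim
        case (elim t)
        then show ?case using s(2)[of "t - x"] by (force simp: dist_real_def abs_minus_commute)
      qed
      then have "eventually (\<lambda>t. t = x) (at y)" by (simp add: eventually_at_filter eventually_mono)
      moreover have "eventually (\<lambda>t. t \<noteq> x) (at y)"
        by (rule eventually_neq_at_within)
      ultimately have "eventually (\<lambda>t. False) (at y)" by eventually_elim auto
      then show False by simp
    qed
    then show thesis by (intro that[of s]) (use s(1) in auto)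
  qed
qed

text \<open>Identity theorem by connected induction on the interval. It carries an equality of germs
  from the start of a ray or segment to its end point.\<close>

lemma analytic_at1_identity:
  assumes \<phi>: "\<And>t. t \<in> {0..b} \<Longrightarrow> analytic_at1 \<phi> t" and \<psi>: "\<And>t. t \<in> {0..b} \<Longrightarrow> analytic_at1 \<psi> t"
    and ev: "eventually (\<lambda>t. \<phi> t = \<psi> t) (nhds 0)" and b: "b \<ge> 0"
  shows "\<phi> b = \<psi> b"
proof -
  let ?\<delta> = "\<lambda>t. \<phi> t - \<psi> t"
  have "eventually (\<lambda>t. ?\<delta> t = 0) (nhds b)"
  proof (rule connected_induction_simple[of "{0..b}" 0 b "\<lambda>x. eventually (\<lambda>t. ?\<delta> t = 0) (nhds x)"])
    fix x assume x: "x \<in> {0..b}"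
    obtain e where e: "e > 0" "\<And>y z. \<bar>y - x\<bar> < e \<Longrightarrow> \<bar>z - x\<bar> < e \<Longrightarrow>
        eventually (\<lambda>t. ?\<delta> t = 0) (nhds y) \<Longrightarrow> eventually (\<lambda>t. ?\<delta> t = 0) (nhds z)"
      using analytic_at1_zero_propagates[OF analytic_at1_diff[OF \<phi>[OF x] \<psi>[OF x]]] by blast
    show "\<exists>T. openin (top_of_set {0..b}) T \<and> x \<in> T \<and> (\<forall>y\<in>T. \<forall>z\<in>T.
        eventually (\<lambda>t. ?\<delta> t = 0) (nhds y) \<longrightarrow> eventually (\<lambda>t. ?\<delta> t = 0) (nhds z))"
      using e x
      by (intro exI[of _ "{0..b} \<inter> ball x e"])
        (auto simp: openin_open dist_real_def abs_minus_commute)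
  qed (use b ev in auto)
  from eventually_nhds_x_imp_x[OF this] show ?thesis by simp
qed

text \<open>Re-expansion about another point: the complex extension \<open>F\<close> is holomorphic
  on the disc of radius \<open>R\<close>, so its Taylor series at \<open>x\<close> converges on the
  largest disc about \<open>x\<close> inside it.\<close>

lemma powser_analytic_at1:
  fixes a :: "nat \<Rightarrow> real"
  assumes sm: "\<And>x. \<bar>x\<bar> < R \<Longrightarrow> (\<lambda>n. a n * x ^ n) sums \<psi> x" and x: "\<bar>x\<bar> < R"
  shows "analytic_at1 \<psi> x"
proof -
  define F where "F z = (\<Sum>n. complex_of_real (a n) * z ^ n)" for z
  have conv: "(\<lambda>n. complex_of_real (a n) * z ^ n) sums F z" if "z \<in> ball 0 R" for z
  proof -
    \<comment> \<open>\<open>powser_inside\<close> asks for convergence at a point of strictly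
      larger modulus.\<close>
    from that obtain y where y: "norm z < y" "y < R" using dense by auto
    then have "\<bar>y\<bar> < R" using norm_ge_zero[of z] by linarith
    from sums_summable[OF sm[OF this]]
    have "summable (\<lambda>n. complex_of_real (a n * y ^ n))" by (rule summable_of_real)
    then have "summable (\<lambda>n. complex_of_real (a n) * (complex_of_real y) ^ n)" by simp
    from powser_inside[OF this, of z] y norm_ge_zero[of z]
    show ?thesis unfolding F_def by (intro summable_sums) auto
  qed
  have Fre: "F (complex_of_real t) = complex_of_real (\<psi> t)" if "\<bar>t\<bar> < R" for t
  proof -
    have "(\<lambda>n. complex_of_real (a n * t ^ n)) sums complex_of_real (\<psi> t)"
      using sm[OF that] by (rule sums_of_real)
    then have "(\<lambda>n. complex_of_real (a n) * (complex_of_real t) ^ n) sums complex_of_real (\<psi> t)"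
      by simp
    with conv[of "complex_of_real t"] that show ?thesis by (auto intro: sums_unique2)
  qed
  have hol: "F holomorphic_on ball 0 R"
    using power_series_holomorphic[of 0 R "\<lambda>n. complex_of_real (a n)" F] conv by simp
  define r where "r = R - \<bar>x\<bar>"
  have sub: "ball (complex_of_real x) r \<subseteq> ball 0 R"
    by (auto simp: r_def dist_norm) (smt (verit) norm_minus_commute norm_of_real norm_triangle_sub)
  let ?d = "\<lambda>n. (deriv ^^ n) F (complex_of_real x) / fact n"
  \<comment> \<open>Since \<open>h\<close> is real, taking real parts termwise turns the complex
    Taylor series into a real one.\<close>
  have "(\<lambda>n. Re (?d n) * h ^ n) sums \<psi> (x + h)" if h: "\<bar>h\<bar> < r" for h
  proof -
    have "(\<lambda>n. ?d n * (complex_of_real (x + h) - complex_of_real x) ^ n) sums F (complex_of_real (x + h))"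
      using h by (intro holomorphic_power_series[OF holomorphic_on_subset[OF hol sub]])
        (simp add: dist_norm)
    then have "(\<lambda>n. ?d n * complex_of_real (h ^ n)) sums complex_of_real (\<psi> (x + h))"
      using Fre[of "x + h"] h by (simp add: r_def)
    from sums_Re[OF this] show ?thesis
      by (simp only: Re_complex_of_real Im_complex_of_real times_complex.sel mult_zero_right diff_0_right)
  qed
  then show ?thesis
    unfolding analytic_at1_def using x by (intro exI[of _ "\<lambda>n. Re (?d n)"] exI[of _ r]) (auto simp: r_def)
qed

subsection \<open>Restriction of power series to lines and planes\<close>

definition mdeg :: "('n::finite \<Rightarrow> nat) \<Rightarrow> nat" where
  "mdeg \<alpha> = (\<Sum>i\<in>UNIV. \<alpha> i)"

definition mmono :: "real ^ 'n \<Rightarrow> ('n \<Rightarrow> nat) \<Rightarrow> real" where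
  "mmono v \<alpha> = (\<Prod>i\<in>UNIV. (v $ i) ^ \<alpha> i)"

lemma mmono_scaleR: "mmono (t *\<^sub>R v) \<alpha> = t ^ mdeg \<alpha> * mmono v \<alpha>"
  by (simp add: mmono_def mdeg_def power_mult_distrib prod.distrib power_sum)

lemma finite_mdeg: "finite {\<alpha> :: 'n::finite \<Rightarrow> nat. mdeg \<alpha> = k}"
proof (rule finite_subset)
  show "{\<alpha> :: 'n \<Rightarrow> nat. mdeg \<alpha> = k} \<subseteq> PiE UNIV (\<lambda>_. {..k})"
    by (auto simp: mdeg_def intro: member_le_sum)
  show "finite (PiE UNIV (\<lambda>_::'n. {..k}))" by (intro finite_PiE) auto
qed

text \<open>Unordered sums may be grouped along the finite level sets of \<open>mdeg\<close>; this
  turns a multivariate power series into the series of its homogeneous parts.\<close>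

lemma has_sum_group_mdeg:
  fixes g :: "('n::finite \<Rightarrow> nat) \<Rightarrow> real"
  assumes "(g has_sum S) UNIV"
  shows "((\<lambda>k. \<Sum>\<alpha>|mdeg \<alpha> = k. g \<alpha>) has_sum S) UNIV"
proof (rule has_sum_SigmaD)
  show "((\<lambda>x. g (snd x)) has_sum S) (Sigma UNIV (\<lambda>k. {\<alpha>. mdeg \<alpha> = k}))"
    using assms
    by (subst has_sum_reindex_bij_witness[of _ "\<lambda>\<alpha>. (mdeg \<alpha>, \<alpha>)" snd UNIV g]) auto
qed (simp add: finite_mdeg)

text \<open>The homogeneous part of degree \<open>k\<close> at \<open>h *\<^sub>R u\<close> is
  \<open>h ^ k\<close> times its value at \<open>u\<close>. The coefficients \<open>c\<close> are
  shared by all directions \<open>u\<close>, hence the Taylor coefficients along rays depend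
  polynomially on the direction.\<close>

lemma real_analytic_at_rays:
  assumes "real_analytic_at F a"
  obtains c r where "r > 0"
    "\<And>u h. norm (h *\<^sub>R u) < r \<Longrightarrow>
      (\<lambda>k. (\<Sum>\<alpha>|mdeg \<alpha> = k. c \<alpha> * mmono u \<alpha>) * h ^ k) sums F (a + h *\<^sub>R u)"
proof -
  obtain c r where c: "r > 0"
    "\<And>x. x \<in> ball a r \<Longrightarrow> ((\<lambda>\<alpha>. c \<alpha> * (\<Prod>i\<in>UNIV. (x $ i - a $ i) ^ \<alpha> i)) has_sum F x) UNIV"
    using assms unfolding real_analytic_at_def by blast
  have "(\<lambda>k. (\<Sum>\<alpha>|mdeg \<alpha> = k. c \<alpha> * mmono u \<alpha>) * h ^ k) sums F (a + h *\<^sub>R u)"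
    if "norm (h *\<^sub>R u) < r" for u h
  proof -
    have "((\<lambda>\<alpha>. c \<alpha> * mmono (h *\<^sub>R u) \<alpha>) has_sum F (a + h *\<^sub>R u)) UNIV"
      using c(2)[of "a + h *\<^sub>R u"] that by (simp add: mmono_def dist_norm)
    from has_sum_imp_sums[OF has_sum_group_mdeg[OF this]] show ?thesis
      by (simp add: mmono_scaleR sum_distrib_left sum_distrib_right mult_ac)
  qed
  with c(1) show thesis by (rule that)
qed

lemma mmono_line_poly:
  obtains q where "degree q \<le> mdeg \<alpha>" "\<And>\<tau>. poly q \<tau> = mmono (u + \<tau> *\<^sub>R w) \<alpha>"
proof
  let ?q = "\<Prod>i\<in>UNIV. [:u $ i, w $ i:] ^ \<alpha> i"
  have "degree ?q \<le> (\<Sum>i\<in>UNIV. degree ([:u $ i, w $ i:] ^ \<alpha> i))"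
    using degree_prod_sum_le[of UNIV "\<lambda>i. [:u $ i, w $ i:] ^ \<alpha> i"] by (simp add: o_def)
  also have "\<dots> \<le> (\<Sum>i\<in>UNIV. \<alpha> i)"
  proof (rule sum_mono)
    fix i
    have "degree ([:u $ i, w $ i:] ^ \<alpha> i) \<le> degree [:u $ i, w $ i:] * \<alpha> i" by (rule degree_power_le)
    also have "\<dots> \<le> 1 * \<alpha> i" by (intro mult_right_mono) auto
    finally show "degree ([:u $ i, w $ i:] ^ \<alpha> i) \<le> \<alpha> i" by simp
  qed
  finally show "degree ?q \<le> mdeg \<alpha>" by (simp add: mdeg_def)
  show "poly ?q \<tau> = mmono (u + \<tau> *\<^sub>R w) \<alpha>" for \<tau>
    by (simp add: poly_prod mmono_def)
qed

text \<open>Adapts an arbitrary chart of the plane to the base point \<open>y\<close>: the origin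
  \<open>p\<close> of the chart may differ from \<open>y\<close>, so \<open>y\<close> gets a
  coordinate \<open>s0\<close>, and directions are pulled back through \<open>L\<close>.\<close>

lemma plane_coords:
  fixes y :: "real ^ 'n"
  assumes "real_analytic_on_plane f ((+) y ` span {v, w}) U"
  obtains p and L :: "real ^ 2 \<Rightarrow> real ^ 'n" and s0 where "linear L" "y = p + L s0"
    "\<And>x. x \<in> span {v, w} \<Longrightarrow> \<exists>u. x = L u"
    "\<And>s. p + L s \<in> U \<Longrightarrow> real_analytic_at (\<lambda>s. f (p + L s)) s"
proof -
  obtain p and L :: "real ^ 2 \<Rightarrow> real ^ 'n" where L: "linear L"
    "range (\<lambda>s. p + L s) = (+) y ` span {v, w}"
    "\<And>s. p + L s \<in> U \<Longrightarrow> real_analytic_at (\<lambda>s. f (p + L s)) s"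
    using assms unfolding real_analytic_on_plane_def real_analytic_on_def by blast
  have *: "\<exists>s. y + x = p + L s" if "x \<in> span {v, w}" for x
    using L(2) that by (metis (no_types, lifting) imageE imageI)
  from *[of 0] obtain s0 where s0: "y = p + L s0" by (auto simp: span_zero)
  have "\<exists>u. x = L u" if x: "x \<in> span {v, w}" for x
  proof -
    obtain s where "y + x = p + L s" using *[OF x] by blast
    then have "x = L (s - s0)" using s0 by (simp add: linear_diff[OF L(1)] algebra_simps)
    then show ?thesis by blast
  qed
  with L s0 show thesis by (intro that[of L p s0])
qed

lemma plane_line_analytic:
  fixes y :: "real ^ 'n"
  assumes P: "real_analytic_on_plane f ((+) y ` span {v, w}) U"
    and x: "x \<in> span {v, w}" and U: "y + t *\<^sub>R x \<in> U"
  shows "analytic_at1 (\<lambda>t. f (y + t *\<^sub>R x)) t"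
proof -
  obtain p and L :: "real ^ 2 \<Rightarrow> real ^ 'n" and s0 where L: "linear L" "y = p + L s0"
    "\<And>x. x \<in> span {v, w} \<Longrightarrow> \<exists>u. x = L u"
    "\<And>s. p + L s \<in> U \<Longrightarrow> real_analytic_at (\<lambda>s. f (p + L s)) s"
    using plane_coords[OF P] by metis
  obtain u where u: "x = L u" using L(3)[OF x] by blast
  have eq: "y + s *\<^sub>R x = p + L (s0 + s *\<^sub>R u)" for s
    by (simp add: L(2) u linear_add[OF L(1)] linear_scale[OF L(1)])
  have in_U: "p + L (s0 + t *\<^sub>R u) \<in> U" using U eq[of t] by simp
  obtain c r where c: "r > 0" "\<And>u' h. norm (h *\<^sub>R u') < r \<Longrightarrow>
      (\<lambda>k. (\<Sum>\<alpha>|mdeg \<alpha> = k. c \<alpha> * mmono u' \<alpha>) * h ^ k) sums f (p + L (s0 + t *\<^sub>R u + h *\<^sub>R u'))"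
    by (rule real_analytic_at_rays[OF L(4)[OF in_U]]) (rule that)
  show ?thesis unfolding analytic_at1_def
  proof (intro exI conjI allI impI)
    \<comment> \<open>Adding 1 keeps the denominator positive when \<open>u = 0\<close>.\<close>
    show "r / (norm u + 1) > 0" using c(1) by (intro divide_pos_pos) (auto intro: add_nonneg_pos)
    fix h :: real assume h: "\<bar>h\<bar> < r / (norm u + 1)"
    have "norm (h *\<^sub>R u) \<le> \<bar>h\<bar> * (norm u + 1)" by (simp add: mult_left_mono)
    also have "\<dots> < r" using h norm_ge_zero[of u] by (simp add: field_simps)
    finally have "norm (h *\<^sub>R u) < r" .
    from c(2)[OF this]
    show "(\<lambda>n. (\<Sum>\<alpha>|mdeg \<alpha> = n. c \<alpha> * mmono u \<alpha>) * h ^ n) sums f (y + (t + h) *\<^sub>R x)"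
      unfolding eq by (simp add: scaleR_left_distrib add.assoc)
  qed
qed

text \<open>Pull \<open>v\<close> and \<open>w\<close> back to the chart as \<open>u1\<close> and
  \<open>u2\<close>. The degree \<open>k\<close> part of the series at \<open>s0\<close>, restricted
  to the line \<open>u1 + \<tau> *\<^sub>R u2\<close>, is a polynomial in \<tau> of degree at most
  \<open>k\<close>. The radius of convergence may depend on \<tau>, the polynomials do not.\<close>

lemma plane_taylor_poly:
  fixes y :: "real ^ 'n"
  assumes P: "real_analytic_on_plane f ((+) y ` span {v, w}) U" and y: "y \<in> U"
  obtains q where "\<And>k. degree (q k) \<le> k"
    "\<And>\<tau>. \<exists>r>0. \<forall>h. \<bar>h\<bar> < r \<longrightarrow> (\<lambda>k. poly (q k) \<tau> * h ^ k) sums f (y + h *\<^sub>R (v + \<tau> *\<^sub>R w))"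
proof -
  obtain p and L :: "real ^ 2 \<Rightarrow> real ^ 'n" and s0 where L: "linear L" "y = p + L s0"
    "\<And>x. x \<in> span {v, w} \<Longrightarrow> \<exists>u. x = L u"
    "\<And>s. p + L s \<in> U \<Longrightarrow> real_analytic_at (\<lambda>s. f (p + L s)) s"
    using plane_coords[OF P] by metis
  obtain u1 u2 where u: "v = L u1" "w = L u2"
    using L(3)[of v] L(3)[of w] by (auto simp: span_base)
  have in_U: "p + L s0 \<in> U" using y L(2) by simp
  obtain c r where c: "r > 0" "\<And>u' h. norm (h *\<^sub>R u') < r \<Longrightarrow>
      (\<lambda>k. (\<Sum>\<alpha>|mdeg \<alpha> = k. c \<alpha> * mmono u' \<alpha>) * h ^ k) sums f (p + L (s0 + h *\<^sub>R u'))"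
    by (rule real_analytic_at_rays[OF L(4)[OF in_U]]) (rule that)
  have "\<forall>\<alpha>. \<exists>q. degree q \<le> mdeg \<alpha> \<and> (\<forall>\<tau>. poly q \<tau> = mmono (u1 + \<tau> *\<^sub>R u2) \<alpha>)"
    using mmono_line_poly by metis
  then obtain Q where Q: "\<And>\<alpha>. degree (Q \<alpha>) \<le> mdeg \<alpha>"
      "\<And>\<alpha> \<tau>. poly (Q \<alpha>) \<tau> = mmono (u1 + \<tau> *\<^sub>R u2) \<alpha>" by metis
  define q where "q k = (\<Sum>\<alpha>|mdeg \<alpha> = k. smult (c \<alpha>) (Q \<alpha>))" for k
  have deg: "degree (q k) \<le> k" for k
    unfolding q_def using Q(1)
    by (intro degree_sum_le finite_mdeg) (use degree_smult_le le_trans in blast)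
  have "\<exists>r>0. \<forall>h. \<bar>h\<bar> < r \<longrightarrow> (\<lambda>k. poly (q k) \<tau> * h ^ k) sums f (y + h *\<^sub>R (v + \<tau> *\<^sub>R w))" for \<tau>
  proof (intro exI conjI allI impI)
    let ?u = "u1 + \<tau> *\<^sub>R u2"
    show "r / (norm ?u + 1) > 0" using c(1) by (intro divide_pos_pos) (auto intro: add_nonneg_pos)
    fix h :: real assume h: "\<bar>h\<bar> < r / (norm ?u + 1)"
    have "norm (h *\<^sub>R ?u) \<le> \<bar>h\<bar> * (norm ?u + 1)" by (simp add: mult_left_mono)
    also have "\<dots> < r" using h norm_ge_zero[of ?u] by (simp add: field_simps)
    finally have "norm (h *\<^sub>R ?u) < r" .
    from c(2)[OF this]
    show "(\<lambda>k. poly (q k) \<tau> * h ^ k) sums f (y + h *\<^sub>R (v + \<tau> *\<^sub>R w))"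
      by (simp add: L(2) u q_def poly_sum Q(2) linear_add[OF L(1)] linear_scale[OF L(1)] add.assoc)
  qed
  with deg show thesis by (rule that)
qed

text \<open>The choice refers to the function alone, so coefficients computed in different planes
  through the same line coincide, by \<open>powser_coeff_unique\<close>. Without a convergent
  expansion at 0 the value is arbitrary.\<close>

definition taylor_coeff :: "(real \<Rightarrow> real) \<Rightarrow> nat \<Rightarrow> real" where
  "taylor_coeff \<phi> = (SOME c. \<exists>r>0. \<forall>h. \<bar>h\<bar> < r \<longrightarrow> (\<lambda>n. c n * h ^ n) sums \<phi> h)"

lemma taylor_coeff_eq:
  assumes "\<exists>r>0. \<forall>h. \<bar>h\<bar> < r \<longrightarrow> (\<lambda>n. c n * h ^ n) sums \<phi> h"
  shows "taylor_coeff \<phi> = c"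
proof -
  have "\<exists>r>0. \<forall>h. \<bar>h\<bar> < r \<longrightarrow> (\<lambda>n. taylor_coeff \<phi> n * h ^ n) sums \<phi> h"
    unfolding taylor_coeff_def by (rule someI[of _ c]) (rule assms)
  then obtain r where r: "r > 0" "\<And>h. \<bar>h\<bar> < r \<Longrightarrow> (\<lambda>n. taylor_coeff \<phi> n * h ^ n) sums \<phi> h"
    by blast
  obtain r' where r': "r' > 0" "\<And>h. \<bar>h\<bar> < r' \<Longrightarrow> (\<lambda>n. c n * h ^ n) sums \<phi> h"
    using assms by blast
  show ?thesis by (rule powser_coeff_unique[OF r r'])
qed

subsection \<open>Interpolation in several variables\<close>

lemma lagrange_interpolation:
  fixes x :: "nat \<Rightarrow> real"
  assumes inj: "inj_on x {..k}" and deg: "degree q \<le> k"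
  shows "poly q t = (\<Sum>j\<le>k. (\<Prod>m\<in>{..k}-{j}. (t - x m) / (x j - x m)) * poly q (x j))"
proof -
  define l where "l j = (\<Prod>m\<in>{..k}-{j}. smult (1 / (x j - x m)) [:- x m, 1:])" for j
  define P where "P = (\<Sum>j\<le>k. smult (poly q (x j)) (l j))"
  have l: "poly (l j) t = (\<Prod>m\<in>{..k}-{j}. (t - x m) / (x j - x m))" for j t
    by (simp add: l_def poly_prod diff_divide_distrib)
  have "degree (l j) \<le> k" if "j \<le> k" for j
  proof -
    have "degree (l j) \<le> (\<Sum>m\<in>{..k}-{j}. degree (smult (1 / (x j - x m)) [:- x m, 1:]))"
      unfolding l_def
      by (rule order_trans[OF degree_prod_sum_le]) (simp_all only: finite_Diff finite_atMost o_def order_refl)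
    also have "\<dots> \<le> (\<Sum>m\<in>{..k}-{j}. 1)"
      by (intro sum_mono) (auto simp: degree_smult_le)
    also have "\<dots> = k" using that by simp
    finally show ?thesis .
  qed
  then have degP: "degree P \<le> k" unfolding P_def
    by (intro degree_sum_le) (auto intro: le_trans[OF degree_smult_le])
  have lii: "poly (l j) (x i) = (if i = j then 1 else 0)" if "i \<le> k" "j \<le> k" for i j
  proof (cases "i = j")
    case True
    have "(x j - x m) / (x j - x m) = 1" if "m \<in> {..k} - {j}" for m
      using inj that \<open>j \<le> k\<close> by (auto simp: inj_on_def)
    then show ?thesis using True by (simp add: l)
  next
    case False
    then show ?thesis using that by (auto simp: l)
  qed
  have "q = P"
  proof (rule poly_eqI_degree[of "x ` {..k}"])
    fix z assume "z \<in> x ` {..k}"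
    then obtain i where i: "i \<le> k" "z = x i" by auto
    have "poly P (x i) = (\<Sum>j\<le>k. if i = j then poly q (x j) else 0)"
      unfolding P_def poly_sum poly_smult using i(1) by (intro sum.cong refl) (simp add: lii)
    also have "\<dots> = poly q (x i)" using i(1) by simp
    finally show "poly q z = poly P z" by (simp add: i)
  next
    have "card (x ` {..k}) = Suc k" by (subst card_image[OF inj]) simp
    then show "degree q < card (x ` {..k})" "degree P < card (x ` {..k})"
      using deg degP by linarith+
  qed
  then have "poly q t = poly P t" by simp
  also have "\<dots> = (\<Sum>j\<le>k. (\<Prod>m\<in>{..k}-{j}. (t - x m) / (x j - x m)) * poly q (x j))"
    by (simp add: P_def poly_sum l mult.commute)
  finally show ?thesis .
qed

text \<open>The nodes below \<open>j\<close> contribute \<open>fact j\<close> and those above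
  contribute \<open>fact (k - j)\<close>. These are the Lagrange denominators for equispaced nodes,
  and they turn the sum over \<open>j\<close> into one of binomial coefficients.\<close>

lemma prod_dist_naturals:
  assumes "j \<le> k"
  shows "(\<Prod>m\<in>{..k}-{j}. \<bar>real j - real m\<bar>) = fact j * fact (k - j)"
proof -
  have "{..k} - {j} = {..<j} \<union> {j<..k}" using assms by auto
  then have "(\<Prod>m\<in>{..k}-{j}. \<bar>real j - real m\<bar>) =
      (\<Prod>m<j. \<bar>real j - real m\<bar>) * (\<Prod>m\<in>{j<..k}. \<bar>real j - real m\<bar>)"
    by (simp add: prod.union_disjoint disjoint_iff)
  also have "(\<Prod>m<j. \<bar>real j - real m\<bar>) = (\<Prod>i=1..j. real i)"
    by (rule prod.reindex_bij_witness[of _ "\<lambda>i. j - i" "\<lambda>i. j - i"]) auto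
  also have "(\<Prod>m\<in>{j<..k}. \<bar>real j - real m\<bar>) = (\<Prod>i=1..k-j. real i)"
    by (rule prod.reindex_bij_witness[of _ "\<lambda>i. j + i" "\<lambda>i. i - j"]) auto
  finally show ?thesis by (simp add: fact_prod)
qed

text \<open>The interpolation nodes are \<open>h j / (k + 1)\<close> for \<open>j \<le> k\<close>, and \<open>C\<close> bounds the norms of the
  linear factors of the Lagrange polynomials.\<close>

definition lebesgue_bound :: "nat \<Rightarrow> real \<Rightarrow> real \<Rightarrow> real" where
  "lebesgue_bound k C h =
    (\<Sum>j\<le>k. \<Prod>m\<in>{..k}-{j}. C / \<bar>h * real j / real (k+1) - h * real m / real (k+1)\<bar>)"

text \<open>With \<open>D = C * (k+1) / h\<close> the sum equals
  \<open>(2 * D) ^ k / fact k\<close>. The quotient \<open>(k+1) ^ k / fact k\<close> is one term of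
  the series of \<open>exp (k+1)\<close>, hence at most \<open>3 ^ (k+1)\<close>. The bound is
  therefore geometric in \<open>k\<close>, although the nodes get closer as \<open>k\<close>
  grows.\<close>

lemma lebesgue_bound_le:
  assumes "C \<ge> 0" "h > 0"
  shows "lebesgue_bound k C h \<le> 3 * (6 * C / h) ^ k"
proof -
  define D where "D = C * real (k+1) / h"
  have D: "D \<ge> 0" using assms by (simp add: D_def)
  have "lebesgue_bound k C h = (\<Sum>j\<le>k. D ^ k / (fact j * fact (k - j)))"
    unfolding lebesgue_bound_def
  proof (rule sum.cong[OF refl])
    fix j assume j: "j \<in> {..k}"
    have "C / \<bar>h * real j / real (k+1) - h * real m / real (k+1)\<bar> = D / \<bar>real j - real m\<bar>" for m
    proof -
      have "h * real j / real (k+1) - h * real m / real (k+1) = h / real (k+1) * (real j - real m)"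
        by (simp add: right_diff_distrib diff_divide_distrib)
      then show ?thesis using assms by (simp add: abs_mult D_def)
    qed
    then have "(\<Prod>m\<in>{..k}-{j}. C / \<bar>h * real j / real (k+1) - h * real m / real (k+1)\<bar>) =
        D ^ card ({..k}-{j}) / (\<Prod>m\<in>{..k}-{j}. \<bar>real j - real m\<bar>)"
      by (simp add: prod_dividef)
    then show "(\<Prod>m\<in>{..k}-{j}. C / \<bar>h * real j / real (k+1) - h * real m / real (k+1)\<bar>) =
        D ^ k / (fact j * fact (k - j))"
      using j by (simp add: prod_dist_naturals)
  qed
  also have "\<dots> = (\<Sum>j\<le>k. real (k choose j)) * (D ^ k / fact k)"
    unfolding sum_distrib_right by (intro sum.cong) (auto simp: binomial_fact)
  also have "(\<Sum>j\<le>k. real (k choose j)) = 2 ^ k"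
    using choose_row_sum[of k] by (metis of_nat_sum of_nat_power of_nat_numeral)
  also have "D ^ k / fact k = (C / h) ^ k * (real (k+1) ^ k / fact k)"
    unfolding D_def power_divide power_mult_distrib by simp
  also have "2 ^ k * ((C / h) ^ k * (real (k+1) ^ k / fact k)) \<le> 2 ^ k * ((C / h) ^ k * 3 ^ (k+1))"
  proof -
    have "real (k+1) ^ k / fact k \<le> exp (real (k+1))"
    proof -
      have "(\<lambda>n. real (k+1) ^ n / fact n) sums exp (real (k+1))"
        using exp_converges[of "real (k+1)"] by (simp add: field_simps)
      from sum_le_suminf[OF sums_summable[OF this], of "{k}"] sums_unique[OF this]
      show ?thesis by simp
    qed
    also have "\<dots> = exp 1 ^ (k+1)" using exp_of_nat_mult[of "k+1" "1::real"] by simp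
    also have "\<dots> \<le> 3 ^ (k+1)" using exp_le by (intro power_mono) auto
    finally show ?thesis using assms by (intro mult_left_mono) auto
  qed
  also have "\<dots> = 3 * (6 * C / h) ^ k"
  proof -
    have "6 * C / h = 2 * 3 * (C / h)" by simp
    then show ?thesis by (simp only: power_mult_distrib power_add power_one_right mult_ac)
  qed
  finally show ?thesis .
qed

text \<open>\<open>N g A\<close> abstracts ``\<open>g\<close> has norm at most \<open>A\<close>'', so that the same induction on the set of
  coordinates gives continuity (ignoring \<open>A\<close>) and bounds on power series coefficients.\<close>

lemma separate_interpolation:
  fixes N :: "('v \<Rightarrow> real) \<Rightarrow> real \<Rightarrow> bool" and S :: "'n \<Rightarrow> 'v \<Rightarrow> real"
    and \<phi> :: "('n \<Rightarrow> real) \<Rightarrow> real"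
  assumes N_zero: "N (\<lambda>_. 0) 0"
    and N_add: "\<And>g A g' A'. N g A \<Longrightarrow> N g' A' \<Longrightarrow> N (\<lambda>v. g v + g' v) (A + A')"
    and N_scale: "\<And>g A c. N g A \<Longrightarrow> N (\<lambda>v. c * g v) (\<bar>c\<bar> * A)"
    and N_coord: "\<And>g A i c. N g A \<Longrightarrow> 0 \<le> c \<Longrightarrow> c \<le> h \<Longrightarrow> N (\<lambda>v. (S i v - c) * g v) (C * A)"
    and h: "h > 0"
    and poly: "\<And>s i. (\<And>j. \<bar>s j\<bar> \<le> h) \<Longrightarrow>
      \<exists>q. degree q \<le> k \<and> (\<forall>\<tau>. \<bar>\<tau>\<bar> \<le> h \<longrightarrow> \<phi> (s(i := \<tau>)) = poly q \<tau>)"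
    and N_val: "\<And>s. (\<And>j. \<bar>s j\<bar> \<le> h) \<Longrightarrow> N (\<lambda>_. \<phi> s) B"
    and I: "finite I" and s: "\<And>j. \<bar>s j\<bar> \<le> h"
  shows "\<exists>H. N H (lebesgue_bound k C h ^ card I * B) \<and>
    (\<forall>v. (\<forall>i\<in>I. \<bar>S i v\<bar> \<le> h) \<longrightarrow> H v = \<phi> (\<lambda>i. if i \<in> I then S i v else s i))"
  using I s
proof (induction I arbitrary: s rule: finite_induct)
  case empty
  show ?case
    by (rule exI[of _ "\<lambda>_. \<phi> s"]) (use N_val[OF empty] in simp)
next
  case (insert i I)
  define x where "x j = h * real j / real (k+1)" for j
  let ?\<Lambda> = "lebesgue_bound k C h"
  have x: "0 \<le> x j" "x j \<le> h" if "j \<le> k" for j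
    using that h mult_left_mono[of "real j" "real (k+1)" h] by (auto simp: x_def pos_divide_le_eq)
  have inj: "inj_on x {..k}" using h by (auto simp: inj_on_def x_def)
  \<comment> \<open>The induction hypothesis is used once per node: \<open>H\<close> represents
    \<phi> with the coordinates in \<open>I\<close> free and coordinate \<open>i\<close> frozen at
    \<open>x j\<close>.\<close>
  define P where "P j H \<longleftrightarrow> N H (?\<Lambda> ^ card I * B) \<and> (\<forall>v. (\<forall>i\<in>I. \<bar>S i v\<bar> \<le> h) \<longrightarrow>
      H v = \<phi> (\<lambda>l. if l \<in> I then S l v else (s(i := x j)) l))" for j H
  have "\<exists>H. P j H" if "j \<le> k" for j
    unfolding P_def using insert.prems x[OF that] by (intro insert.IH) auto
  then have "\<forall>j\<in>{..k}. \<exists>H. P j H" by simp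
  from bchoice[OF this] obtain H where PH: "\<forall>j\<in>{..k}. P j (H j)" by blast
  have H: "N (H j) (?\<Lambda> ^ card I * B)"
    "(\<forall>i\<in>I. \<bar>S i v\<bar> \<le> h) \<Longrightarrow> H j v = \<phi> (\<lambda>l. if l \<in> I then S l v else (s(i := x j)) l)"
    if "j \<le> k" for j v
    using PH that unfolding P_def by simp_all
  \<comment> \<open>Each linear factor costs \<open>C\<close> because its node lies between 0 and
    \<open>h\<close>, and dividing it costs \<open>1 / \<bar>x j - x m\<bar>\<close>.\<close>
  have N_prod: "N (\<lambda>v. (\<Prod>m\<in>M. (S i v - x m) / (x j - x m)) * g v) ((\<Prod>m\<in>M. C / \<bar>x j - x m\<bar>) * A)"
    if "finite M" "M \<subseteq> {..k}" "N g A" for M j g A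
    using that
  proof (induction M rule: finite_induct)
    case (insert m M)
    from insert have "N (\<lambda>v. (S i v - x m) * ((\<Prod>m\<in>M. (S i v - x m) / (x j - x m)) * g v))
        (C * ((\<Prod>m\<in>M. C / \<bar>x j - x m\<bar>) * A))"
      by (intro N_coord x) auto
    from N_scale[OF this, of "inverse (x j - x m)"] insert.hyps show ?case
      by (simp add: divide_inverse mult_ac)
  qed simp
  have N_sum: "N (\<lambda>v. \<Sum>j\<in>M. g j v) (\<Sum>j\<in>M. A j)"
    if "finite M" "\<And>j. j \<in> M \<Longrightarrow> N (g j) (A j)" for M :: "nat set" and g A
    using that by (induction M rule: finite_induct) (auto intro: N_add N_zero)
  \<comment> \<open>The interpolation formula is defined for every \<open>v\<close>, while agreement
    with \<phi> is claimed on the box only. This extension is what makes expansions about other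
    centres meaningful.\<close>
  let ?H = "\<lambda>v. \<Sum>j\<le>k. (\<Prod>m\<in>{..k}-{j}. (S i v - x m) / (x j - x m)) * H j v"
  have "N ?H (\<Sum>j\<le>k. (\<Prod>m\<in>{..k}-{j}. C / \<bar>x j - x m\<bar>) * (?\<Lambda> ^ card I * B))"
    by (intro N_sum N_prod H) auto
  also have "(\<Sum>j\<le>k. (\<Prod>m\<in>{..k}-{j}. C / \<bar>x j - x m\<bar>) * (?\<Lambda> ^ card I * B)) = ?\<Lambda> * (?\<Lambda> ^ card I * B)"
    unfolding lebesgue_bound_def x_def by (rule sum_distrib_right[symmetric])
  also have "\<dots> = ?\<Lambda> ^ card (insert i I) * B" using insert.hyps by simp
  finally have N_H: "N ?H (?\<Lambda> ^ card (insert i I) * B)" .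
  have H_eq: "?H v = \<phi> (\<lambda>l. if l \<in> insert i I then S l v else s l)"
    if v: "\<forall>l\<in>insert i I. \<bar>S l v\<bar> \<le> h" for v
  proof -
    \<comment> \<open>Along coordinate \<open>i\<close> through \<sigma>, the function \<phi> is a
      polynomial of degree at most \<open>k\<close>, recovered from its values at the
      \<open>k + 1\<close> nodes.\<close>
    define \<sigma> where "\<sigma> l = (if l \<in> I then S l v else s l)" for l
    have "\<bar>\<sigma> l\<bar> \<le> h" for l using v insert.prems by (auto simp: \<sigma>_def)
    then obtain q where q: "degree q \<le> k" "\<And>\<tau>. \<bar>\<tau>\<bar> \<le> h \<Longrightarrow> \<phi> (\<sigma>(i := \<tau>)) = poly q \<tau>"
      using poly by blast
    have "H j v = poly q (x j)" if "j \<le> k" for j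
    proof -
      have "(\<lambda>l. if l \<in> I then S l v else (s(i := x j)) l) = \<sigma>(i := x j)"
        using insert.hyps by (auto simp: \<sigma>_def)
      then show ?thesis using H(2)[OF that, of v] v q(2)[of "x j"] x[OF that] by auto
    qed
    then have "?H v = (\<Sum>j\<le>k. (\<Prod>m\<in>{..k}-{j}. (S i v - x m) / (x j - x m)) * poly q (x j))"
      by simp
    also have "\<dots> = poly q (S i v)" by (rule lagrange_interpolation[OF inj q(1), symmetric])
    also have "\<dots> = \<phi> (\<sigma>(i := S i v))" using v by (intro q(2)[symmetric]) simp
    also have "\<sigma>(i := S i v) = (\<lambda>l. if l \<in> insert i I then S l v else s l)"
      by (auto simp: \<sigma>_def)
    finally show ?thesis .
  qed
  show ?case
    by (rule exI[of _ ?H], rule conjI, rule N_H, rule allI, rule impI, rule H_eq)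
qed

subsection \<open>Power series with summable coefficients\<close>

text \<open>This says that the weighted l1 norm of the expansion about \<open>x0\<close> on the
  closed polydisc of radius \<rho> is at most \<open>A\<close>. The shape of a predicate in
  \<open>g\<close> and \<open>A\<close> fits the parameter \<open>N\<close> of
  \<open>separate_interpolation\<close>, and evaluating \<open>g\<close> at \<open>x0 + v\<close>
  lets one \<open>g\<close> have expansions about several centres.\<close>

definition l1_series :: "real ^ 'n \<Rightarrow> real \<Rightarrow> (real ^ 'n \<Rightarrow> real) \<Rightarrow> real \<Rightarrow> bool" where
  "l1_series x0 \<rho> g A \<longleftrightarrow> (\<exists>c s. ((\<lambda>\<alpha>. \<bar>c \<alpha>\<bar> * \<rho> ^ mdeg \<alpha>) has_sum s) UNIV \<and> s \<le> A \<and>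
     (\<forall>v. (\<forall>i. \<bar>v $ i\<bar> \<le> \<rho>) \<longrightarrow> ((\<lambda>\<alpha>. c \<alpha> * mmono v \<alpha>) has_sum g (x0 + v)) UNIV))"

lemma abs_mmono_le:
  assumes "\<And>i. \<bar>v $ i\<bar> \<le> \<rho>"
  shows "\<bar>mmono v \<alpha>\<bar> \<le> \<rho> ^ mdeg \<alpha>"
  unfolding mmono_def mdeg_def abs_prod power_sum
  by (intro prod_mono) (auto simp: power_abs intro: power_mono assms)

lemma l1_seriesI:
  assumes "(W has_sum s) UNIV" "s \<le> A" "\<rho> \<ge> 0" "\<And>\<alpha>. \<bar>c \<alpha>\<bar> * \<rho> ^ mdeg \<alpha> \<le> W \<alpha>"
    and "\<And>v. (\<And>i. \<bar>v $ i\<bar> \<le> \<rho>) \<Longrightarrow> ((\<lambda>\<alpha>. c \<alpha> * mmono v \<alpha>) has_sum g (x0 + v)) UNIV"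
  shows "l1_series x0 \<rho> g A"
proof -
  have "(\<lambda>\<alpha>. \<bar>c \<alpha>\<bar> * \<rho> ^ mdeg \<alpha>) summable_on UNIV"
    using assms(3) by (intro summable_on_comparison_test[OF has_sum_imp_summable[OF assms(1)]] assms(4)) auto
  then obtain s' where s': "((\<lambda>\<alpha>. \<bar>c \<alpha>\<bar> * \<rho> ^ mdeg \<alpha>) has_sum s') UNIV"
    by (auto simp: summable_on_def)
  have "s' \<le> s" by (rule has_sum_mono[OF s' assms(1)]) (rule assms(4))
  with s' assms(2,5) show ?thesis
    unfolding l1_series_def by (intro exI[of _ c] exI[of _ s']) auto
qed

lemma l1_series_const: "\<rho> \<ge> 0 \<Longrightarrow> l1_series x0 \<rho> (\<lambda>_. b) \<bar>b\<bar>"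
proof (rule l1_seriesI[where c = "\<lambda>\<alpha>. if \<alpha> = (\<lambda>_. 0) then b else 0"])
  show "((\<lambda>\<alpha>::'a \<Rightarrow> nat. if \<alpha> = (\<lambda>_. 0) then \<bar>b\<bar> else 0) has_sum \<bar>b\<bar>) UNIV"
    by (rule has_sum_finite_neutralI[of "{\<lambda>_. 0}"]) auto
  show "((\<lambda>\<alpha>. (if \<alpha> = (\<lambda>_. 0) then b else 0) * mmono v \<alpha>) has_sum b) UNIV" for v :: "real ^ 'a"
    by (rule has_sum_finite_neutralI[of "{\<lambda>_. 0}"]) (auto simp: mmono_def)
qed (auto simp: mdeg_def)

lemma l1_series_nonneg:
  fixes g :: "real ^ 'n \<Rightarrow> real"
  assumes "l1_series x0 \<rho> g A" "\<rho> \<ge> 0"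
  shows "A \<ge> 0"
proof -
  obtain c :: "('n \<Rightarrow> nat) \<Rightarrow> real" and s
    where c: "((\<lambda>\<alpha>. \<bar>c \<alpha>\<bar> * \<rho> ^ mdeg \<alpha>) has_sum s) UNIV" "s \<le> A"
    using assms(1) unfolding l1_series_def by blast
  have "s \<ge> 0" by (rule has_sum_nonneg[OF c(1)]) (use assms(2) in simp)
  with c(2) show ?thesis by simp
qed

lemma l1_series_mono: "l1_series x0 \<rho> g A \<Longrightarrow> A \<le> B \<Longrightarrow> l1_series x0 \<rho> g B"
  unfolding l1_series_def using order_trans by blast

lemma l1_series_add:
  assumes "\<rho> \<ge> 0" "l1_series x0 \<rho> g A" "l1_series x0 \<rho> g' A'"
  shows "l1_series x0 \<rho> (\<lambda>v. g v + g' v) (A + A')"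
proof -
  obtain c s where c: "((\<lambda>\<alpha>. \<bar>c \<alpha>\<bar> * \<rho> ^ mdeg \<alpha>) has_sum s) UNIV" "s \<le> A"
     "\<forall>v. (\<forall>i. \<bar>v $ i\<bar> \<le> \<rho>) \<longrightarrow> ((\<lambda>\<alpha>. c \<alpha> * mmono v \<alpha>) has_sum g (x0 + v)) UNIV"
    using assms(2) unfolding l1_series_def by blast
  obtain c' s' where c': "((\<lambda>\<alpha>. \<bar>c' \<alpha>\<bar> * \<rho> ^ mdeg \<alpha>) has_sum s') UNIV" "s' \<le> A'"
     "\<forall>v. (\<forall>i. \<bar>v $ i\<bar> \<le> \<rho>) \<longrightarrow> ((\<lambda>\<alpha>. c' \<alpha> * mmono v \<alpha>) has_sum g' (x0 + v)) UNIV"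
    using assms(3) unfolding l1_series_def by blast
  show ?thesis
  proof (rule l1_seriesI[where c = "\<lambda>\<alpha>. c \<alpha> + c' \<alpha>", OF has_sum_add[OF c(1) c'(1)]])
    show "\<bar>c \<alpha> + c' \<alpha>\<bar> * \<rho> ^ mdeg \<alpha> \<le> \<bar>c \<alpha>\<bar> * \<rho> ^ mdeg \<alpha> + \<bar>c' \<alpha>\<bar> * \<rho> ^ mdeg \<alpha>" for \<alpha>
      unfolding distrib_right[symmetric] using assms(1) by (intro mult_right_mono) auto
    show "((\<lambda>\<alpha>. (c \<alpha> + c' \<alpha>) * mmono v \<alpha>) has_sum g (x0 + v) + g' (x0 + v)) UNIV"
      if "\<And>i. \<bar>v $ i\<bar> \<le> \<rho>" for v
      using has_sum_add[OF c(3)[rule_format, OF that] c'(3)[rule_format, OF that]] by (simp add: distrib_right)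
  qed (use assms c c' in auto)
qed

lemma l1_series_scale:
  assumes "l1_series x0 \<rho> g A"
  shows "l1_series x0 \<rho> (\<lambda>v. b * g v) (\<bar>b\<bar> * A)"
proof -
  obtain c s where c: "((\<lambda>\<alpha>. \<bar>c \<alpha>\<bar> * \<rho> ^ mdeg \<alpha>) has_sum s) UNIV" "s \<le> A"
     "\<forall>v. (\<forall>i. \<bar>v $ i\<bar> \<le> \<rho>) \<longrightarrow> ((\<lambda>\<alpha>. c \<alpha> * mmono v \<alpha>) has_sum g (x0 + v)) UNIV"
    using assms unfolding l1_series_def by blast
  have "((\<lambda>\<alpha>. \<bar>b * c \<alpha>\<bar> * \<rho> ^ mdeg \<alpha>) has_sum (\<bar>b\<bar> * s)) UNIV"
    using has_sum_cmult_right[OF c(1), of "\<bar>b\<bar>"] by (simp add: abs_mult mult.assoc)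
  moreover have "((\<lambda>\<alpha>. b * c \<alpha> * mmono v \<alpha>) has_sum b * g (x0 + v)) UNIV"
    if "\<And>i. \<bar>v $ i\<bar> \<le> \<rho>" for v
    using has_sum_cmult_right[OF c(3)[rule_format, OF that], of b] by (simp add: mult.assoc)
  ultimately show ?thesis unfolding l1_series_def
    using c(2) by (intro exI[of _ "\<lambda>\<alpha>. b * c \<alpha>"] exI[of _ "\<bar>b\<bar> * s"]) (auto intro: mult_left_mono)
qed

lemma mdeg_upd_Suc: "mdeg (\<alpha>(i := Suc (\<alpha> i))) = Suc (mdeg \<alpha>)"
  unfolding mdeg_def by (simp add: sum.remove[of UNIV i])

lemma mmono_upd_Suc: "mmono v (\<alpha>(i := Suc (\<alpha> i))) = v $ i * mmono v \<alpha>"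
  unfolding mmono_def by (simp add: prod.remove[of UNIV i])

text \<open>Multiplication by a coordinate shifts the multi-indices injectively; the image consists
  of those with \<open>\<alpha> i > 0\<close>, and the remaining terms vanish.\<close>

lemma has_sum_shift_index:
  fixes F :: "('n \<Rightarrow> nat) \<Rightarrow> real"
  assumes "((\<lambda>\<alpha>. F (\<alpha>(i := Suc (\<alpha> i)))) has_sum s) UNIV" and "\<And>\<alpha>. \<alpha> i = 0 \<Longrightarrow> F \<alpha> = 0"
  shows "(F has_sum s) UNIV"
proof -
  have "(F has_sum s) {\<alpha>. \<alpha> i > 0}"
    using assms(1)
    by (subst has_sum_reindex_bij_witness[of _ "\<lambda>\<alpha>. \<alpha>(i := Suc (\<alpha> i))" "\<lambda>\<alpha>. \<alpha>(i := \<alpha> i - 1)" UNIV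
          "\<lambda>\<alpha>. F (\<alpha>(i := Suc (\<alpha> i)))"]) auto
  moreover have "(F has_sum s) UNIV \<longleftrightarrow> (F has_sum s) {\<alpha>. \<alpha> i > 0}"
    by (rule has_sum_cong_neutral) (auto simp: assms(2))
  ultimately show ?thesis by simp
qed

lemma l1_series_coord:
  assumes "l1_series x0 \<rho> g A" "\<rho> \<ge> 0"
  shows "l1_series x0 \<rho> (\<lambda>v. (v $ i - x0 $ i) * g v) (\<rho> * A)"
proof -
  obtain c s where c: "((\<lambda>\<alpha>. \<bar>c \<alpha>\<bar> * \<rho> ^ mdeg \<alpha>) has_sum s) UNIV" "s \<le> A"
     "\<forall>v. (\<forall>i. \<bar>v $ i\<bar> \<le> \<rho>) \<longrightarrow> ((\<lambda>\<alpha>. c \<alpha> * mmono v \<alpha>) has_sum g (x0 + v)) UNIV"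
    using assms(1) unfolding l1_series_def by blast
  define d where "d \<alpha> = (if \<alpha> i = 0 then 0 else c (\<alpha>(i := \<alpha> i - 1)))" for \<alpha>
  have d_Suc [simp]: "d (\<alpha>(i := Suc (\<alpha> i))) = c \<alpha>" for \<alpha> by (simp add: d_def)
  have "((\<lambda>\<alpha>. \<bar>d \<alpha>\<bar> * \<rho> ^ mdeg \<alpha>) has_sum (\<rho> * s)) UNIV"
  proof (rule has_sum_shift_index[of _ i])
    show "((\<lambda>\<alpha>. \<bar>d (\<alpha>(i := Suc (\<alpha> i)))\<bar> * \<rho> ^ mdeg (\<alpha>(i := Suc (\<alpha> i)))) has_sum (\<rho> * s)) UNIV"
      using has_sum_cmult_right[OF c(1), of \<rho>] by (simp add: mdeg_upd_Suc mult_ac)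
  qed (simp add: d_def)
  moreover have "((\<lambda>\<alpha>. d \<alpha> * mmono v \<alpha>) has_sum (v $ i * g (x0 + v))) UNIV"
    if "\<And>i. \<bar>v $ i\<bar> \<le> \<rho>" for v
  proof (rule has_sum_shift_index[of _ i])
    show "((\<lambda>\<alpha>. d (\<alpha>(i := Suc (\<alpha> i))) * mmono v (\<alpha>(i := Suc (\<alpha> i)))) has_sum (v $ i * g (x0 + v))) UNIV"
      using has_sum_cmult_right[OF c(3)[rule_format, OF that], of "v $ i"] by (simp add: mmono_upd_Suc mult_ac)
  qed (simp add: d_def)
  ultimately show ?thesis unfolding l1_series_def
    using c(2) assms(2) by (intro exI[of _ d] exI[of _ "\<rho> * s"]) (auto intro: mult_left_mono)
qed

text \<open>In skew coordinates the linear factors of the Lagrange polynomials are affine functions.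
  Expanded about \<open>x0\<close>, such a factor has norm equal to the modulus of its constant term
  plus \<rho> times the sum of the moduli of its slopes.\<close>

lemma l1_series_affine:
  assumes "l1_series x0 \<rho> g A" "\<rho> \<ge> 0"
  shows "l1_series x0 \<rho> (\<lambda>v. (b + (\<Sum>i\<in>UNIV. d i * (v $ i - x0 $ i))) * g v)
    ((\<bar>b\<bar> + (\<Sum>i\<in>UNIV. \<bar>d i\<bar> * \<rho>)) * A)"
proof -
  have "l1_series x0 \<rho> (\<lambda>v. (b + (\<Sum>i\<in>I. d i * (v $ i - x0 $ i))) * g v)
      ((\<bar>b\<bar> + (\<Sum>i\<in>I. \<bar>d i\<bar> * \<rho>)) * A)" if "finite I" for I
    using that
  proof (induction I rule: finite_induct)
    case empty
    show ?case using l1_series_scale[OF assms(1), of b] by simp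
  next
    case (insert j I)
    from l1_series_add[OF assms(2) insert.IH l1_series_scale[OF l1_series_coord[OF assms, of j], of "d j"]]
    show ?case using insert.hyps by (simp add: algebra_simps)
  qed
  then show ?thesis by simp
qed

text \<open>Completeness of the weighted l1 norm: the double family over
  \<open>(k, \<alpha>)\<close> is absolutely summable, so both orders of summation agree and the
  coefficients can be added up for each \<alpha> separately.\<close>

lemma l1_series_suminf:
  fixes g :: "nat \<Rightarrow> real ^ 'n \<Rightarrow> real"
  assumes g: "\<And>k. l1_series x0 \<rho> (g k) (A k)" and A: "summable A" and \<rho>: "\<rho> > 0"
  shows "l1_series x0 \<rho> (\<lambda>v. \<Sum>k. g k v) (\<Sum>k. A k)"
proof -
  have "\<forall>k. l1_series x0 \<rho> (g k) (A k)" using g by simp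
  then have "\<exists>c s. \<forall>k. ((\<lambda>\<alpha>. \<bar>c k \<alpha>\<bar> * \<rho> ^ mdeg \<alpha>) has_sum s k) UNIV \<and> s k \<le> A k \<and>
      (\<forall>v. (\<forall>i. \<bar>v $ i\<bar> \<le> \<rho>) \<longrightarrow> ((\<lambda>\<alpha>. c k \<alpha> * mmono v \<alpha>) has_sum g k (x0 + v)) UNIV)"
    unfolding l1_series_def choice_iff .
  then obtain c s where cs: "\<forall>k. ((\<lambda>\<alpha>. \<bar>c k \<alpha>\<bar> * \<rho> ^ mdeg \<alpha>) has_sum s k) UNIV \<and> s k \<le> A k \<and>
      (\<forall>v. (\<forall>i. \<bar>v $ i\<bar> \<le> \<rho>) \<longrightarrow> ((\<lambda>\<alpha>. c k \<alpha> * mmono v \<alpha>) has_sum g k (x0 + v)) UNIV)"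
    by (elim exE) (rule that)
  have c: "((\<lambda>\<alpha>. \<bar>c k \<alpha>\<bar> * \<rho> ^ mdeg \<alpha>) has_sum s k) UNIV" "s k \<le> A k"
     "(\<forall>i. \<bar>v $ i\<bar> \<le> \<rho>) \<Longrightarrow> ((\<lambda>\<alpha>. c k \<alpha> * mmono v \<alpha>) has_sum g k (x0 + v)) UNIV" for k v
    using cs by simp_all
  have s0: "s k \<ge> 0" for k using \<rho> by (intro has_sum_nonneg[OF c(1)]) auto
  have s_summable: "summable s"
    using s0 c(2) by (intro summable_comparison_test'[OF A, of 0]) auto
  have T: "(\<lambda>(k, \<alpha>). \<bar>c k \<alpha>\<bar> * \<rho> ^ mdeg \<alpha>) summable_on UNIV \<times> UNIV"
    using c(1) s0 s_summable \<rho>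
    by (intro summable_on_SigmaI[where g = s]) (auto simp: summable_on_UNIV_nonneg_real_iff)
  have F: "(\<lambda>(k, \<alpha>). c k \<alpha> * mmono v \<alpha>) summable_on UNIV \<times> UNIV" if "\<forall>i. \<bar>v $ i\<bar> \<le> \<rho>" for v
  proof (rule abs_summable_summable, rule summable_on_comparison_test[OF T])
    show "norm (case x of (k, \<alpha>) \<Rightarrow> c k \<alpha> * mmono v \<alpha>) \<le> (case x of (k, \<alpha>) \<Rightarrow> \<bar>c k \<alpha>\<bar> * \<rho> ^ mdeg \<alpha>)" for x
      using abs_mmono_le[of v \<rho> "snd x"] that
      by (simp add: case_prod_unfold abs_mult mult_left_mono)
  qed simp
  define C where "C \<alpha> = (\<Sum>\<^sub>\<infinity>k. c k \<alpha>)" for \<alpha>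
  have "(\<lambda>(\<alpha>, k). \<bar>c k \<alpha>\<bar> * \<rho> ^ mdeg \<alpha>) summable_on UNIV \<times> UNIV"
    using summable_on_swap[THEN iffD1, OF T] by simp
  then have c_abs: "(\<lambda>k. \<bar>c k \<alpha>\<bar> * \<rho> ^ mdeg \<alpha>) summable_on UNIV" for \<alpha>
    by (rule summable_on_SigmaD1) simp
  have c_abs': "(\<lambda>k. \<bar>c k \<alpha>\<bar>) summable_on UNIV" for \<alpha>
    using summable_on_cmult_left'[of "\<rho> ^ mdeg \<alpha>" "\<lambda>k. \<bar>c k \<alpha>\<bar>" UNIV] c_abs[of \<alpha>] \<rho> by simp
  have c_sum: "((\<lambda>k. c k \<alpha>) has_sum C \<alpha>) UNIV" for \<alpha>
    unfolding C_def
    by (rule has_sum_infsum, rule abs_summable_summable) (use c_abs' in simp)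
  define W where "W \<alpha> = (\<Sum>\<^sub>\<infinity>k. \<bar>c k \<alpha>\<bar> * \<rho> ^ mdeg \<alpha>)" for \<alpha>
  show ?thesis
  proof (rule l1_seriesI[where c = C and W = W])
    \<comment> \<open>The total \<open>t\<close> is computed in both orders: summing over \<alpha>
      first gives \<open>suminf s\<close>, summing over \<open>k\<close> first gives the sum of
      \<open>W\<close>.\<close>
    obtain t where t: "((\<lambda>(k, \<alpha>). \<bar>c k \<alpha>\<bar> * \<rho> ^ mdeg \<alpha>) has_sum t) (UNIV \<times> UNIV)"
      using T by (auto simp: summable_on_def)
    have "(s has_sum t) UNIV" by (rule has_sum_SigmaD[OF t]) (use c(1) in auto)
    then have t_eq: "t = suminf s" using has_sum_imp_sums sums_unique by blast
    have "((\<lambda>(\<alpha>, k). \<bar>c k \<alpha>\<bar> * \<rho> ^ mdeg \<alpha>) has_sum t) (UNIV \<times> UNIV)"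
      using has_sum_swap[THEN iffD1, OF t] by simp
    from has_sum_SigmaD[OF this, of W] c_abs
    have "(W has_sum t) UNIV" by (simp add: W_def)
    then show "(W has_sum suminf s) UNIV" by (simp add: t_eq)
    show "suminf s \<le> suminf A" by (intro suminf_le c s_summable A)
    show "\<bar>C \<alpha>\<bar> * \<rho> ^ mdeg \<alpha> \<le> W \<alpha>" for \<alpha>
    proof -
      have "\<bar>C \<alpha>\<bar> \<le> (\<Sum>\<^sub>\<infinity>k. \<bar>c k \<alpha>\<bar>)"
        using norm_infsum_bound[of "\<lambda>k. c k \<alpha>" UNIV] c_abs' by (simp add: C_def)
      then show ?thesis
        unfolding W_def using \<rho> by (simp add: infsum_cmult_left' mult_right_mono)
    qed
    show "((\<lambda>\<alpha>. C \<alpha> * mmono v \<alpha>) has_sum (\<Sum>k. g k (x0 + v))) UNIV"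
      if v: "\<And>i. \<bar>v $ i\<bar> \<le> \<rho>" for v
    proof -
      obtain t where t: "((\<lambda>(k, \<alpha>). c k \<alpha> * mmono v \<alpha>) has_sum t) (UNIV \<times> UNIV)"
        using F[of v] v by (auto simp: summable_on_def)
      have "((\<lambda>k. g k (x0 + v)) has_sum t) UNIV" by (rule has_sum_SigmaD[OF t]) (use c(3) v in auto)
      then have t_eq: "t = (\<Sum>k. g k (x0 + v))" using has_sum_imp_sums sums_unique by blast
      have "((\<lambda>(\<alpha>, k). c k \<alpha> * mmono v \<alpha>) has_sum t) (UNIV \<times> UNIV)"
        using has_sum_swap[THEN iffD1, OF t] by simp
      from has_sum_SigmaD[OF this, of "\<lambda>\<alpha>. C \<alpha> * mmono v \<alpha>"] has_sum_cmult_left[OF c_sum]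
      show ?thesis by (simp add: t_eq)
    qed
  qed (use \<rho> in auto)
qed

text \<open>On a line through the centre \<open>x0\<close>, grouping by degree gives a power series
  in the line parameter, which \<open>powser_analytic_at1\<close> re-expands at \<tau>.\<close>

lemma l1_series_line_analytic:
  assumes g: "l1_series x0 \<rho> g A" and R: "R > 0" "\<And>i. R * \<bar>d $ i\<bar> \<le> \<rho>" and \<tau>: "\<bar>\<tau>\<bar> < R"
  shows "analytic_at1 (\<lambda>\<tau>. g (x0 + \<tau> *\<^sub>R d)) \<tau>"
proof -
  obtain c where c:
     "\<forall>v. (\<forall>i. \<bar>v $ i\<bar> \<le> \<rho>) \<longrightarrow> ((\<lambda>\<alpha>. c \<alpha> * mmono v \<alpha>) has_sum g (x0 + v)) UNIV"
    using g unfolding l1_series_def by blast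
  have "(\<lambda>k. (\<Sum>\<alpha>|mdeg \<alpha> = k. c \<alpha> * mmono d \<alpha>) * t ^ k) sums g (x0 + t *\<^sub>R d)" if t: "\<bar>t\<bar> < R" for t
  proof -
    have "\<bar>(t *\<^sub>R d) $ i\<bar> \<le> \<rho>" for i
      using mult_right_mono[of "\<bar>t\<bar>" R "\<bar>d $ i\<bar>"] t R(2)[of i] by (simp add: abs_mult)
    from has_sum_imp_sums[OF has_sum_group_mdeg[OF c[rule_format, OF this]]] show ?thesis
      by (simp add: mmono_scaleR sum_distrib_left sum_distrib_right mult_ac)
  qed
  from powser_analytic_at1[OF this \<tau>] show ?thesis by simp
qed

text \<open>Undoes the scaling \<open>x = a + t *\<^sub>R v\<close>: each monomial picks up
  \<open>t ^ mdeg \<alpha>\<close>, by which its coefficient is divided.\<close>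

lemma l1_series_real_analytic_at:
  assumes g: "l1_series 0 \<rho> g A" and pos: "\<rho> > 0" "t > 0" "e > 0"
    and eq: "\<And>v. norm v < e \<Longrightarrow> f (a + t *\<^sub>R v) = g v"
  shows "real_analytic_at f a"
proof -
  obtain c where c:
     "\<forall>v. (\<forall>i. \<bar>v $ i\<bar> \<le> \<rho>) \<longrightarrow> ((\<lambda>\<alpha>. c \<alpha> * mmono v \<alpha>) has_sum g v) UNIV"
    using g unfolding l1_series_def add_0 by blast
  show ?thesis unfolding real_analytic_at_def
  proof (intro exI conjI ballI)
    show "t * min \<rho> e > 0" using pos by simp
    fix x assume "x \<in> ball a (t * min \<rho> e)"
    define v where "v = (1 / t) *\<^sub>R (x - a)"
    have tv: "x - a = t *\<^sub>R v" using pos by (simp add: v_def)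
    have "norm (x - a) < min \<rho> e * t"
      using \<open>x \<in> ball a (t * min \<rho> e)\<close> by (simp only: mem_ball dist_norm norm_minus_commute mult.commute)
    then have "norm v < min \<rho> e"
      using pos pos_divide_less_eq[of t "norm (x - a)" "min \<rho> e"] by (simp add: v_def)
    then have "\<bar>v $ i\<bar> \<le> \<rho>" for i using component_le_norm_cart[of v i] by simp
    then have "((\<lambda>\<alpha>. c \<alpha> * mmono v \<alpha>) has_sum f (a + t *\<^sub>R v)) UNIV"
      using c eq[of v] \<open>norm v < min \<rho> e\<close> by simp
    moreover have "c \<alpha> / t ^ mdeg \<alpha> * (\<Prod>i\<in>UNIV. (x $ i - a $ i) ^ \<alpha> i) = c \<alpha> * mmono v \<alpha>" for \<alpha>
    proof -
      have "(\<Prod>i\<in>UNIV. (x $ i - a $ i) ^ \<alpha> i) = mmono (t *\<^sub>R v) \<alpha>"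
        unfolding tv[symmetric] by (simp add: mmono_def)
      then show ?thesis using pos by (simp add: mmono_scaleR)
    qed
    ultimately show "((\<lambda>\<alpha>. c \<alpha> / t ^ mdeg \<alpha> * (\<Prod>i\<in>UNIV. (x $ i - a $ i) ^ \<alpha> i)) has_sum f x) UNIV"
      by (simp add: tv[symmetric])
  qed
qed

section \<open>Baire category, skew coordinates and geometric coefficient bounds\<close>

text \<open>If every \<open>K \<inter> E M\<close> had empty interior, each \<open>K - E M\<close>
  would be relatively open and dense in \<open>K\<close>; density passes from the interior to all of
  \<open>K\<close> by convexity. Baire then makes their intersection dense, but it is empty because
  of the cover.\<close>

lemma closed_cover_interior:
  fixes K :: "'a::euclidean_space set" and E :: "nat \<Rightarrow> 'a set"
  assumes K: "closed K" "convex K" "interior K \<noteq> {}"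
    and E: "\<And>M. closed (E M)" and cover: "K \<subseteq> (\<Union>M. E M)"
  obtains M where "interior (K \<inter> E M) \<noteq> {}"
proof (rule ccontr)
  assume "\<not> thesis"
  then have empty: "interior (K \<inter> E M) = {}" for M using that by blast
  have "K \<subseteq> closure (\<Inter>(range (\<lambda>M. K - E M)))"
  proof (rule Baire[OF K(1)])
    fix T assume "T \<in> range (\<lambda>M. K - E M)"
    then obtain M where T: "T = K - E M" by blast
    have "interior K \<subseteq> closure T"
    proof
      fix x assume x: "x \<in> interior K"
      show "x \<in> closure T"
        unfolding closure_iff_nhds_not_empty
      proof (intro allI impI)
        fix A V assume V: "V \<subseteq> A" "open V" "x \<in> V"
        have "open (V \<inter> interior K)" "V \<inter> interior K \<noteq> {}" using V x by auto
        then have "\<not> V \<inter> interior K \<subseteq> K \<inter> E M"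
          using interior_maximal[of "V \<inter> interior K" "K \<inter> E M"] empty by blast
        then show "T \<inter> A \<noteq> {}" using V(1) T interior_subset[of K] by blast
      qed
    qed
    then have "closure (interior K) \<subseteq> closure T" by (rule closure_minimal) simp
    moreover have "closure (interior K) = K"
      using convex_closure_interior[OF K(2,3)] K(1) by simp
    moreover have "openin (top_of_set K) T"
      unfolding T using E[of M] by (auto simp: openin_open Diff_eq intro!: exI[of _ "- E M"])
    ultimately show "openin (top_of_set K) T \<and> K \<subseteq> closure T" by simp
  qed simp
  also have "\<Inter>(range (\<lambda>M. K - E M)) = {}" using cover by auto
  finally show False using K(3) by simp
qed

text \<open>All basis vectors are close to the single vector \<open>u\<close>: each coordinate line through a point
  near \<open>u1\<close> then spans, with the origin, a plane close to the given one.\<close>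

lemma skew_coordinates:
  fixes u :: "real ^ 'n"
  assumes "d > 0"
  obtains w :: "'n \<Rightarrow> real ^ 'n" and D :: "'n \<Rightarrow> 'n \<Rightarrow> real" where
    "\<And>i. w i \<in> ball u d"
    "\<And>x. (\<Sum>i\<in>UNIV. (\<Sum>j\<in>UNIV. D i j * x $ j) *\<^sub>R w i) = x"
    "\<And>s i. (\<Sum>j\<in>UNIV. D i j * (\<Sum>l\<in>UNIV. s l *\<^sub>R w l) $ j) = s i"
proof -
  define U where "U = (\<Sum>i\<in>UNIV. u $ i)"
  \<comment> \<open>The basis vectors will be the columns of \<eta> times the identity plus the
    rank-one matrix all of whose columns are \<open>u\<close>. It is invertible if neither \<eta>
    nor \<open>\<eta> + U\<close> is zero; if \<open>d / 2\<close> fails, \<open>d / 3\<close>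
    works.\<close>
  obtain \<eta> where \<eta>: "0 < \<eta>" "\<eta> < d" "\<eta> + U \<noteq> 0"
  proof (cases "d / 2 + U = 0")
    case True
    then show ?thesis using assms by (intro that[of "d / 3"]) auto
  qed (use assms in \<open>auto intro: that[of "d / 2"]\<close>)
  define w where "w i = u + \<eta> *\<^sub>R axis i 1" for i
  \<comment> \<open>The inverse matrix, by the Sherman-Morrison formula.\<close>
  define D where "D i j = (if i = j then 1 / \<eta> else 0) - u $ i / ((\<eta> + U) * \<eta>)" for i j
  have w_sum: "(\<Sum>l\<in>UNIV. s l *\<^sub>R w l) $ j = (\<Sum>l\<in>UNIV. s l) * u $ j + \<eta> * s j" for s j
  proof -
    have "(\<Sum>l\<in>UNIV. s l *\<^sub>R w l) $ j = (\<Sum>l\<in>UNIV. s l * u $ j + (if j = l then \<eta> * s j else 0))"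
      unfolding sum_component by (intro sum.cong) (auto simp: w_def axis_def algebra_simps)
    then show ?thesis by (simp add: sum.distrib sum_distrib_right)
  qed
  have D_sum: "(\<Sum>j\<in>UNIV. D i j * x $ j) = x $ i / \<eta> - u $ i / ((\<eta> + U) * \<eta>) * (\<Sum>j\<in>UNIV. x $ j)"
    for i and x :: "real ^ 'n"
  proof -
    have "(\<Sum>j\<in>UNIV. D i j * x $ j) =
        (\<Sum>j\<in>UNIV. (if i = j then x $ i / \<eta> else 0) - u $ i / ((\<eta> + U) * \<eta>) * x $ j)"
      by (intro sum.cong) (auto simp: D_def algebra_simps)
    then show ?thesis by (simp add: sum_subtractf sum_distrib_left)
  qed
  show thesis
  proof (rule that[of w D])
    show "w i \<in> ball u d" for i using \<eta> by (simp add: w_def dist_norm norm_axis_1)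
    show "(\<Sum>j\<in>UNIV. D i j * (\<Sum>l\<in>UNIV. s l *\<^sub>R w l) $ j) = s i" for s i
    proof -
      have F: "(\<Sum>j\<in>UNIV. (\<Sum>l\<in>UNIV. s l *\<^sub>R w l) $ j) = (\<eta> + U) * (\<Sum>l\<in>UNIV. s l)"
        unfolding w_sum sum.distrib U_def sum_distrib_left[symmetric] sum_distrib_right[symmetric]
        by (simp add: algebra_simps)
      show ?thesis using \<eta> unfolding D_sum F unfolding w_sum by (simp add: add_divide_distrib)
    qed
    show "(\<Sum>i\<in>UNIV. (\<Sum>j\<in>UNIV. D i j * x $ j) *\<^sub>R w i) = x" for x
    proof (subst vec_eq_iff, intro allI)
      fix j
      let ?X = "\<Sum>j\<in>UNIV. x $ j"
      have "(\<Sum>i\<in>UNIV. \<Sum>j\<in>UNIV. D i j * x $ j) = ?X / \<eta> - U / ((\<eta> + U) * \<eta>) * ?X"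
        unfolding D_sum by (simp add: sum_subtractf U_def flip: sum_divide_distrib sum_distrib_right)
      also have "\<dots> = ?X / (\<eta> + U)"
      proof -
        have "?X / \<eta> - (\<sigma> - \<eta>) / (\<sigma> * \<eta>) * ?X = ?X / \<sigma>" if "\<sigma> \<noteq> 0" for \<sigma>
          using \<eta> that by (simp add: field_simps)
        from this[OF \<eta>(3)] show ?thesis by simp
      qed
      finally have X: "(\<Sum>i\<in>UNIV. \<Sum>j\<in>UNIV. D i j * x $ j) = ?X / (\<eta> + U)" .
      show "(\<Sum>i\<in>UNIV. (\<Sum>j\<in>UNIV. D i j * x $ j) *\<^sub>R w i) $ j = x $ j"
        unfolding w_sum X unfolding D_sum using \<eta> by (simp add: right_diff_distrib)
    qed
  qed
qed

text \<open>The terms at \<open>h = r / 2\<close> are bounded by some \<open>B\<close>, and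
  \<open>M\<close> dominates both \<open>B\<close> and \<open>2 / r\<close>. A single natural number
  thus encodes constant and rate, which yields the countable cover for Baire's theorem.\<close>

lemma powser_coeff_bound:
  fixes c :: "nat \<Rightarrow> real"
  assumes "r > 0" and sm: "\<And>h. \<bar>h\<bar> < r \<Longrightarrow> (\<lambda>n. c n * h ^ n) sums \<phi> h"
  obtains M :: nat where "\<And>k. \<bar>c k\<bar> \<le> real M ^ (k + 1)"
proof -
  have "summable (\<lambda>n. c n * (r / 2) ^ n)" using sm[of "r / 2"] assms(1) by (auto intro: sums_summable)
  then have "(\<lambda>n. c n * (r / 2) ^ n) \<longlonglongrightarrow> 0" by (rule summable_LIMSEQ_zero)
  then have "Bseq (\<lambda>n. c n * (r / 2) ^ n)" by (intro convergent_imp_Bseq convergentI)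
  then obtain B where B: "\<And>n. \<bar>c n * (r / 2) ^ n\<bar> \<le> B" by (auto simp: Bseq_def)
  obtain M :: nat where M: "max B (2 / r) \<le> real M" using real_arch_simple by blast
  have "\<bar>c k\<bar> \<le> real M ^ (k + 1)" for k
  proof -
    have "\<bar>c k\<bar> = \<bar>c k * (r / 2) ^ k\<bar> * (2 / r) ^ k"
      using assms(1) by (simp add: abs_mult power_divide)
    also have "\<dots> \<le> real M * real M ^ k"
      using B[of k] M assms(1) by (intro mult_mono power_mono) auto
    finally show ?thesis by simp
  qed
  then show thesis by (rule that)
qed

lemma geometric_coeff_analytic_at1:
  fixes c :: "nat \<Rightarrow> real"
  assumes c: "\<And>k. \<bar>c k\<bar> \<le> M ^ (k + 1)" and t: "\<bar>t\<bar> * M < 1" and M: "M \<ge> 0"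
  shows "analytic_at1 (\<lambda>t. \<Sum>k. c k * t ^ k) t"
proof -
  have sm: "summable (\<lambda>k. c k * x ^ k)" if x: "\<bar>x\<bar> * M < 1" for x
  proof (rule summable_comparison_test')
    show "summable (\<lambda>k. M * (\<bar>x\<bar> * M) ^ k)"
      using x M by (intro summable_mult summable_geometric) (auto simp: abs_mult)
    show "norm (c k * x ^ k) \<le> M * (\<bar>x\<bar> * M) ^ k" if "k \<ge> 0" for k
      using mult_right_mono[OF c[of k], of "\<bar>x\<bar> ^ k"]
      by (simp add: abs_mult power_abs power_mult_distrib mult_ac)
  qed
  \<comment> \<open>The strict inequality leaves room beyond \<open>\<bar>t\<bar>\<close>. The case
    \<open>M = 0\<close> is separate since \<open>1 / M\<close> is then 0.\<close>
  obtain R where R: "\<bar>t\<bar> < R" "R * M < 1"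
  proof (cases "M = 0")
    case True
    then show ?thesis by (intro that[of "\<bar>t\<bar> + 1"]) auto
  next
    case False
    then have "\<bar>t\<bar> < 1 / M" using t M by (simp add: field_simps)
    then obtain R where "\<bar>t\<bar> < R" "R < 1 / M" using dense by blast
    then show ?thesis using False M by (intro that[of R]) (auto simp: field_simps)
  qed
  have "(\<lambda>k. c k * x ^ k) sums (\<Sum>k. c k * x ^ k)" if "\<bar>x\<bar> < R" for x
  proof (rule summable_sums, rule sm)
    show "\<bar>x\<bar> * M < 1" using mult_right_mono[of "\<bar>x\<bar>" R M] that M R(2) by linarith
  qed
  then show ?thesis
    using R(1) by (rule powser_analytic_at1)
qed

section \<open>Separately polynomial functions on a box\<close>

text \<open>Interpolation with \<open>N\<close> read as continuity extends each
  \<open>\<phi> k\<close> continuously from the cube to the whole space. The sets where all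
  \<open>k\<close> obey the bound with the same \<open>M\<close> are therefore closed and, by the
  pointwise bounds, cover the cube; one of them contains a smaller cube.\<close>

lemma separate_poly_locally_bounded:
  fixes \<phi> :: "nat \<Rightarrow> ('n::finite \<Rightarrow> real) \<Rightarrow> real"
  assumes h: "h > 0"
    and poly: "\<And>k s i. (\<And>j. \<bar>s j\<bar> \<le> h) \<Longrightarrow>
      \<exists>q. degree q \<le> k \<and> (\<forall>\<tau>. \<bar>\<tau>\<bar> \<le> h \<longrightarrow> \<phi> k (s(i := \<tau>)) = poly q \<tau>)"
    and bound: "\<And>s. (\<And>j. \<bar>s j\<bar> \<le> h) \<Longrightarrow> \<exists>M::nat. \<forall>k. \<bar>\<phi> k s\<bar> \<le> real M ^ (k + 1)"
  obtains M :: nat and s0 h' where "h' > 0"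
    "\<forall>s. (\<forall>j. \<bar>s j - s0 j\<bar> \<le> h') \<longrightarrow> (\<forall>j. \<bar>s j\<bar> \<le> h) \<and> (\<forall>k. \<bar>\<phi> k s\<bar> \<le> real M ^ (k + 1))"
proof -
  define K :: "(real ^ 'n) set" where "K = cbox (\<chi> i. - h) (\<chi> i. h)"
  have K: "x \<in> K \<longleftrightarrow> (\<forall>j. \<bar>x $ j\<bar> \<le> h)" for x
    unfolding K_def mem_box_cart by (auto simp: abs_le_iff) (metis minus_le_iff)+
  have "\<exists>H. continuous_on UNIV H \<and> (\<forall>v::real^'n. (\<forall>i\<in>UNIV. \<bar>v $ i\<bar> \<le> h) \<longrightarrow>
      H v = \<phi> k (\<lambda>i. if i \<in> UNIV then v $ i else 0))" for k
    by (rule separate_interpolation[where N = "\<lambda>g _. continuous_on UNIV g" and S = "\<lambda>i v. v $ i"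
          and k = k and h = h and \<phi> = "\<phi> k" and s = "\<lambda>_. 0"])
      (use h poly in \<open>auto intro!: continuous_intros\<close>)
  then have "\<forall>k. \<exists>H. continuous_on UNIV H \<and> (\<forall>v\<in>K. H v = \<phi> k (($) v))"
    by (simp add: K Ball_def)
  from choice[OF this] obtain H where H: "\<forall>k. continuous_on UNIV (H k) \<and> (\<forall>v\<in>K. H k v = \<phi> k (($) v))"
    by blast
  define E where "E M = (\<Inter>k. {x. \<bar>H k x\<bar> \<le> real M ^ (k + 1)})" for M :: nat
  have "closed (E M)" for M
    unfolding E_def
  proof (intro closed_INT ballI closed_Collect_le)
    show "continuous_on UNIV (\<lambda>x. \<bar>H k x\<bar>)" for k using H by (intro continuous_intros) simp
  qed (rule continuous_on_const)
  moreover have "K \<subseteq> (\<Union>M. E M)"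
  proof
    fix x assume x: "x \<in> K"
    then obtain M :: nat where "\<forall>k. \<bar>\<phi> k (($) x)\<bar> \<le> real M ^ (k + 1)"
      using bound[of "($) x"] K by auto
    then have "x \<in> E M" using H x unfolding E_def by simp
    then show "x \<in> (\<Union>M. E M)" by blast
  qed
  moreover have "interior K \<noteq> {}"
  proof -
    have "0 \<in> interior K" using h unfolding K_def interior_cbox mem_box_cart by simp
    then show ?thesis by blast
  qed
  moreover have "closed K" "convex K" unfolding K_def by (simp_all add: convex_box closed_cbox)
  ultimately obtain M where "interior (K \<inter> E M) \<noteq> {}"
    using closed_cover_interior[of K E] by metis
  then obtain x where "x \<in> interior (K \<inter> E M)" by blast
  then obtain r where r: "r > 0" "ball x r \<subseteq> K \<inter> E M" unfolding mem_interior by blast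
  \<comment> \<open>Small enough that the cube of half-width \<open>h'\<close> lies in the Euclidean
    ball, via the l1 norm.\<close>
  define h' where "h' = r / (2 * real CARD('n))"
  have h': "h' > 0" using r by (simp add: h'_def)
  have in_ball: "(\<chi> i. s i) \<in> ball x r" if "\<And>j. \<bar>s j - x $ j\<bar> \<le> h'" for s
  proof -
    have "norm ((\<chi> i. s i) - x) \<le> (\<Sum>i\<in>UNIV. \<bar>((\<chi> i. s i) - x) $ i\<bar>)" by (rule norm_le_l1_cart)
    also have "\<dots> \<le> (\<Sum>i\<in>(UNIV::'n set). h')" using that by (intro sum_mono) simp
    also have "\<dots> = r / 2" by (simp add: h'_def)
    finally show ?thesis using r by (simp add: dist_norm norm_minus_commute)
  qed
  show thesis
  proof (rule that[OF h', of "($) x" M], intro allI impI conjI)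
    fix s j assume s: "\<forall>j. \<bar>s j - x $ j\<bar> \<le> h'"
    have "(\<chi> i. s i) \<in> ball x r" by (rule in_ball) (use s in simp)
    then have 1: "(\<chi> i. s i) \<in> K" "(\<chi> i. s i) \<in> E M" using r by blast+
    from 1(1) show "\<bar>s j\<bar> \<le> h" by (simp add: K)
    have "\<bar>H k (\<chi> i. s i)\<bar> \<le> real M ^ (k + 1)" for k using 1(2) unfolding E_def by blast
    moreover have "($) (\<chi> i. s i) = s" by auto
    ultimately show "\<bar>\<phi> k s\<bar> \<le> real M ^ (k + 1)" for k using H 1(1) by simp
  qed
qed

text \<open>Interpolation with \<open>N\<close> read as the weighted l1 bound at all centres in
  \<open>X\<close> simultaneously, so that one \<open>H\<close> serves every centre. The constant
  \<open>C\<close> dominates the norms of the factors \<open>S i v - c\<close> about each of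
  them.\<close>

lemma separate_poly_l1_series:
  fixes \<phi> :: "('n::finite \<Rightarrow> real) \<Rightarrow> real" and D :: "'n \<Rightarrow> 'n \<Rightarrow> real" and b :: "'n \<Rightarrow> real"
    and X :: "(real ^ 'n) set"
  defines "S \<equiv> \<lambda>i v. b i + (\<Sum>j\<in>UNIV. D i j * v $ j)"
  assumes h: "h > 0" and \<rho>: "\<rho> \<ge> 0"
    and poly: "\<And>s i. (\<And>j. \<bar>s j\<bar> \<le> h) \<Longrightarrow>
      \<exists>q. degree q \<le> k \<and> (\<forall>\<tau>. \<bar>\<tau>\<bar> \<le> h \<longrightarrow> \<phi> (s(i := \<tau>)) = poly q \<tau>)"
    and bound: "\<And>s. (\<And>j. \<bar>s j\<bar> \<le> h) \<Longrightarrow> \<bar>\<phi> s\<bar> \<le> B"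
    and C: "\<And>x i. x \<in> X \<Longrightarrow> \<bar>S i x\<bar> + h + (\<Sum>j\<in>UNIV. \<bar>D i j\<bar> * \<rho>) \<le> C"
  shows "\<exists>H. (\<forall>x\<in>X. l1_series x \<rho> H (lebesgue_bound k C h ^ CARD('n) * B)) \<and>
    (\<forall>v. (\<forall>i. \<bar>S i v\<bar> \<le> h) \<longrightarrow> H v = \<phi> (\<lambda>i. S i v))"
proof -
  have "\<exists>H. (\<forall>x\<in>X. l1_series x \<rho> H (lebesgue_bound k C h ^ CARD('n) * B)) \<and>
    (\<forall>v. (\<forall>i\<in>UNIV. \<bar>S i v\<bar> \<le> h) \<longrightarrow> H v = \<phi> (\<lambda>i. if i \<in> UNIV then S i v else 0))"
  proof (rule separate_interpolation[where N = "\<lambda>g A. \<forall>x\<in>X. l1_series x \<rho> g A" and S = S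
        and k = k and h = h and \<phi> = \<phi> and s = "\<lambda>_. 0"])
    show "\<forall>x\<in>X. l1_series x \<rho> (\<lambda>_. 0) 0"
    proof
      show "l1_series x \<rho> (\<lambda>_. 0) 0" for x :: "real ^ 'n"
        using l1_series_const[OF \<rho>, of x 0] by simp
    qed
    show "\<forall>x\<in>X. l1_series x \<rho> (\<lambda>_. \<phi> s) B" if "\<And>j. \<bar>s j\<bar> \<le> h" for s
      by (intro ballI l1_series_mono[OF l1_series_const[OF \<rho>]] bound that)
    show "\<forall>x\<in>X. l1_series x \<rho> (\<lambda>v. (S i v - c) * g v) (C * A)"
      if g: "\<forall>x\<in>X. l1_series x \<rho> g A" and c: "0 \<le> c" "c \<le> h" for g A i c
    proof
      fix x assume x: "x \<in> X"
      then have gx: "l1_series x \<rho> g A" using g by blast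
      define e where "e = S i x - c"
      have eq: "S i v - c = e + (\<Sum>j\<in>UNIV. D i j * (v $ j - x $ j))" for v
        by (simp add: e_def S_def algebra_simps sum_subtractf)
      have "(\<bar>e\<bar> + (\<Sum>j\<in>UNIV. \<bar>D i j\<bar> * \<rho>)) * A \<le> C * A"
        using C[OF x, of i] c l1_series_nonneg[OF gx \<rho>]
        unfolding e_def by (intro mult_right_mono) auto
      with l1_series_affine[OF gx \<rho>, of e "D i"]
      show "l1_series x \<rho> (\<lambda>v. (S i v - c) * g v) (C * A)"
        unfolding eq by (rule l1_series_mono)
    qed
  next
    show "\<forall>x\<in>X. l1_series x \<rho> (\<lambda>v. g v + g' v) (A + A')"
      if "\<forall>x\<in>X. l1_series x \<rho> g A" "\<forall>x\<in>X. l1_series x \<rho> g' A'" for g A g' A'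
    proof
      fix x assume "x \<in> X"
      with that show "l1_series x \<rho> (\<lambda>v. g v + g' v) (A + A')"
        by (intro l1_series_add[OF \<rho>]) simp_all
    qed
    show "\<forall>x\<in>X. l1_series x \<rho> (\<lambda>v. c * g v) (\<bar>c\<bar> * A)" if "\<forall>x\<in>X. l1_series x \<rho> g A" for g A c
    proof
      fix x assume "x \<in> X"
      with that show "l1_series x \<rho> (\<lambda>v. c * g v) (\<bar>c\<bar> * A)" by (intro l1_series_scale) simp
    qed
  qed (use h poly in auto)
  then show ?thesis by simp
qed

subsection \<open>Functions analytic on planes\<close>

text \<open>A direction \<open>v\<close> near \<open>u1\<close> is completed to an admissible plane
  by \<open>u2\<close> itself. The scalar \<open>c\<close> admits multiples of \<open>v\<close>, in
  particular negative ones.\<close>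

lemma line_analytic_on_planes:
  assumes planes: "\<And>y v w. y \<in> ball a d \<Longrightarrow> v \<in> ball u1 d \<Longrightarrow> w \<in> ball u2 d \<Longrightarrow>
      real_analytic_on_plane f ((+) y ` span {v, w}) U"
    and U: "ball a d \<subseteq> U" and y: "y \<in> ball a d" and v: "v \<in> ball u1 d" and d: "d > 0"
    and t: "y + t *\<^sub>R (c *\<^sub>R v) \<in> ball a d"
  shows "analytic_at1 (\<lambda>t. f (y + t *\<^sub>R (c *\<^sub>R v))) t"
  by (rule plane_line_analytic[OF planes[OF y v centre_in_ball[THEN iffD2, OF d]]])
    (use t U in \<open>auto intro: span_scale span_base\<close>)

text \<open>Local form of the theorem. Planes are given by a point near \<open>a\<close> and two
  directions near \<open>u1\<close> and \<open>u2\<close>, which suits skew coordinates: a line in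
  direction \<open>w i\<close> through a vector near \<open>u1\<close> spans such a plane together
  with the origin.\<close>

proposition real_analytic_at_if_planes:
  fixes f :: "real ^ 'n \<Rightarrow> real"
  assumes d: "d > 0" and U: "ball a d \<subseteq> U"
    and planes: "\<And>y v w. y \<in> ball a d \<Longrightarrow> v \<in> ball u1 d \<Longrightarrow> w \<in> ball u2 d \<Longrightarrow>
      real_analytic_on_plane f ((+) y ` span {v, w}) U"
  shows "real_analytic_at f a"
proof -
  have aU: "a \<in> ball a d" using d by simp
  obtain w :: "'n \<Rightarrow> real ^ 'n" and D where w: "\<And>i. w i \<in> ball u2 d"
    and wD: "\<And>x. (\<Sum>i\<in>UNIV. (\<Sum>j\<in>UNIV. D i j * x $ j) *\<^sub>R w i) = x"
    and Dw: "\<And>s i. (\<Sum>j\<in>UNIV. D i j * (\<Sum>l\<in>UNIV. s l *\<^sub>R w l) $ j) = s i"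
    by (rule skew_coordinates[OF d, of u2]) (rule that)
  define T where "T s = u1 + (\<Sum>i\<in>UNIV. s i *\<^sub>R w i)" for s
  define S where "S i v = (\<Sum>j\<in>UNIV. D i j * (v - u1) $ j)" for i v
  have TS: "T (\<lambda>i. S i v) = v" for v by (simp add: T_def S_def wD del: vector_minus_component)
  have ST: "S i (T s) = s i" for i s unfolding T_def S_def add_diff_cancel_left' by (rule Dw)
  \<comment> \<open>Chosen so that the box of half-width \<open>h\<close> in skew coordinates maps
    into \<open>ball u1 (d / 2)\<close>.\<close>
  define h where "h = d / (4 * ((\<Sum>i\<in>UNIV. norm (w i)) + 1))"
  have wpos: "(\<Sum>i\<in>UNIV. norm (w i)) \<ge> 0" by (intro sum_nonneg) simp
  have h: "h > 0" using d wpos by (simp add: h_def)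
  have T_ball: "T s \<in> ball u1 (d / 2)" if s: "\<And>j. \<bar>s j\<bar> \<le> h" for s
  proof -
    have "norm (\<Sum>i\<in>UNIV. s i *\<^sub>R w i) \<le> (\<Sum>i\<in>UNIV. h * norm (w i))"
      by (intro sum_norm_le) (simp add: mult_right_mono s)
    also have "\<dots> \<le> h * ((\<Sum>i\<in>UNIV. norm (w i)) + 1)" using h by (simp add: sum_distrib_left[symmetric])
    also have "\<dots> = d / 4" using wpos by (simp add: h_def field_simps add_nonneg_eq_0_iff)
    finally show ?thesis using d by (simp add: T_def dist_norm)
  qed
  define \<phi> where "\<phi> k s = taylor_coeff (\<lambda>t. f (a + t *\<^sub>R T s)) k" for k s
  have poly: "\<exists>q. \<forall>k. degree (q k) \<le> k \<and> (\<forall>\<tau>. \<phi> k (s(i := \<tau>)) = poly (q k) \<tau>)"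
    and series: "\<exists>r>0. \<forall>t. \<bar>t\<bar> < r \<longrightarrow> (\<lambda>k. \<phi> k s * t ^ k) sums f (a + t *\<^sub>R T s)"
    if s: "\<And>j. \<bar>s j\<bar> \<le> h" for s i
  proof -
    \<comment> \<open>Varying coordinate \<open>i\<close> moves the direction along
      \<open>w i\<close>, so one plane, and one family \<open>q\<close>, serves all \<tau>.\<close>
    have T_upd: "T (s(i := \<tau>)) = T (s(i := 0)) + \<tau> *\<^sub>R w i" for \<tau>
      by (simp add: T_def sum.remove[of UNIV i])
    have "T (s(i := 0)) \<in> ball u1 (d / 2)" by (rule T_ball) (use s h in auto)
    then have "T (s(i := 0)) \<in> ball u1 d" using d by simp
    note plane = planes[OF aU this w[of i]]
    obtain q where q: "\<And>k. degree (q k) \<le> k"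
      "\<And>\<tau>. \<exists>r>0. \<forall>t. \<bar>t\<bar> < r \<longrightarrow>
        (\<lambda>k. poly (q k) \<tau> * t ^ k) sums f (a + t *\<^sub>R (T (s(i := 0)) + \<tau> *\<^sub>R w i))"
      by (rule plane_taylor_poly[OF plane subsetD[OF U aU]]) (rule that)
    have \<phi>_q: "\<phi> k (s(i := \<tau>)) = poly (q k) \<tau>" for k \<tau>
      unfolding \<phi>_def T_upd[of \<tau>] using taylor_coeff_eq[OF q(2)[of \<tau>]] by simp
    show "\<exists>q. \<forall>k. degree (q k) \<le> k \<and> (\<forall>\<tau>. \<phi> k (s(i := \<tau>)) = poly (q k) \<tau>)"
      using q(1) \<phi>_q by blast
    show "\<exists>r>0. \<forall>t. \<bar>t\<bar> < r \<longrightarrow> (\<lambda>k. \<phi> k s * t ^ k) sums f (a + t *\<^sub>R T s)"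
      using q(2)[of "s i"] by (simp add: T_upd[of "s i", symmetric] \<phi>_q[symmetric])
  qed
  have bound: "\<exists>M::nat. \<forall>k. \<bar>\<phi> k s\<bar> \<le> real M ^ (k + 1)" if s: "\<And>j. \<bar>s j\<bar> \<le> h" for s
  proof -
    obtain r where r: "r > 0" "\<And>t. \<bar>t\<bar> < r \<Longrightarrow> (\<lambda>k. \<phi> k s * t ^ k) sums f (a + t *\<^sub>R T s)"
      using series[of s, OF s] by blast
    obtain M :: nat where "\<And>k. \<bar>\<phi> k s\<bar> \<le> real M ^ (k + 1)"
      using powser_coeff_bound[of r "\<lambda>k. \<phi> k s" "\<lambda>t. f (a + t *\<^sub>R T s)"] r by blast
    then show ?thesis by blast
  qed
  have poly': "\<exists>q. degree q \<le> k \<and> (\<forall>\<tau>. \<bar>\<tau>\<bar> \<le> h \<longrightarrow> \<phi> k (s(i := \<tau>)) = poly q \<tau>)"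
    if s: "\<And>j. \<bar>s j\<bar> \<le> h" for s i k
    using poly[of s i, OF s] by blast
  obtain M :: nat and s0 h' where h': "h' > 0"
    and near_s0: "\<forall>s. (\<forall>j. \<bar>s j - s0 j\<bar> \<le> h') \<longrightarrow>
      (\<forall>j. \<bar>s j\<bar> \<le> h) \<and> (\<forall>k. \<bar>\<phi> k s\<bar> \<le> real M ^ (k + 1))"
    by (rule separate_poly_locally_bounded[OF h, of \<phi>], rule poly', simp, rule bound, simp, rule that)
  have box: "\<forall>j. \<bar>s j\<bar> \<le> h" and M: "\<bar>\<phi> k s\<bar> \<le> real M ^ (k + 1)"
    if "\<And>j. \<bar>s j - s0 j\<bar> \<le> h'" for s k
    using near_s0 that by simp_all
  define v0 where "v0 = T s0"
  have S_v0: "S i v0 = s0 i" for i by (simp add: v0_def ST)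
  have v0: "v0 \<in> ball u1 (d / 2)" unfolding v0_def by (rule T_ball) (use box[of s0] h' in auto)
  \<comment> \<open>For \<open>norm v < 1\<close> the vector \<open>v - v0\<close> has norm at most
    \<open>norm v0 + 1\<close>; the factor 2 lets the segment from \<open>v0\<close> be prolonged to
    parameters up to 2.\<close>
  define \<rho> where "\<rho> = 2 * norm v0 + 2"
  have \<rho>: "\<rho> > 0" using norm_ge_zero[of v0] by (simp add: \<rho>_def add_nonneg_pos)
  define b where "b i = - (\<Sum>j\<in>UNIV. D i j * u1 $ j) - s0 i" for i
  have S_b: "b i + (\<Sum>j\<in>UNIV. D i j * v $ j) = S i v - s0 i" for i v
    by (simp add: b_def S_def algebra_simps sum_subtractf)
  \<comment> \<open>Summing over \<open>i\<close> dominates every coordinate at once, and both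
    centres \<open>v0\<close> and 0 are included.\<close>
  define C where "C = (\<Sum>i\<in>UNIV. \<bar>S i v0 - s0 i\<bar> + \<bar>S i 0 - s0 i\<bar> + h' + (\<Sum>j\<in>UNIV. \<bar>D i j\<bar> * \<rho>))"
  have C: "\<bar>S i x - s0 i\<bar> + h' + (\<Sum>j\<in>UNIV. \<bar>D i j\<bar> * \<rho>) \<le> C" if "x \<in> {v0, 0}" for x i
  proof -
    have "\<bar>S i x - s0 i\<bar> + h' + (\<Sum>j\<in>UNIV. \<bar>D i j\<bar> * \<rho>) \<le>
        \<bar>S i v0 - s0 i\<bar> + \<bar>S i 0 - s0 i\<bar> + h' + (\<Sum>j\<in>UNIV. \<bar>D i j\<bar> * \<rho>)"
      using that by auto
    also have "\<dots> \<le> C" unfolding C_def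
      using h' \<rho> by (intro member_le_sum) (auto intro!: add_nonneg_nonneg sum_nonneg)
    finally show ?thesis .
  qed
  have C0: "C \<ge> 0" unfolding C_def
    using h' \<rho> by (auto intro!: add_nonneg_nonneg sum_nonneg)
  define \<Lambda> where "\<Lambda> k = lebesgue_bound k C h' ^ CARD('n) * real M ^ (k + 1)" for k
  have "\<exists>H. (\<forall>x\<in>{v0, 0}. l1_series x \<rho> H (\<Lambda> k)) \<and>
      (\<forall>v. (\<forall>i. \<bar>S i v - s0 i\<bar> \<le> h') \<longrightarrow> H v = \<phi> k (\<lambda>i. S i v))" for k
  proof -
    \<comment> \<open>Recentred at \<open>s0\<close>, because the interpolation lemma works on a
      cube about the origin.\<close>
    define \<psi> where "\<psi> s = \<phi> k (\<lambda>i. s0 i + s i)" for s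
    have upd: "(\<lambda>j. s0 j + (s(i := \<tau>)) j) = (\<lambda>j. s0 j + s j)(i := s0 i + \<tau>)" for s i \<tau> by auto
    have poly_\<psi>: "\<exists>q. degree q \<le> k \<and> (\<forall>\<tau>. \<bar>\<tau>\<bar> \<le> h' \<longrightarrow> \<psi> (s(i := \<tau>)) = poly q \<tau>)"
      if s: "\<And>j. \<bar>s j\<bar> \<le> h'" for s i
    proof -
      have "\<bar>s0 j + s j\<bar> \<le> h" for j using box[of "\<lambda>j. s0 j + s j"] s by simp
      from poly[of "\<lambda>j. s0 j + s j" i, OF this] obtain q where q: "degree (q k) \<le> k"
        "\<And>\<tau>. \<phi> k ((\<lambda>j. s0 j + s j)(i := \<tau>)) = poly (q k) \<tau>" by blast
      have "degree (pcompose (q k) [:s0 i, 1:]) \<le> k" using q(1) by (simp add: degree_pcompose)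
      moreover have "\<psi> (s(i := \<tau>)) = poly (pcompose (q k) [:s0 i, 1:]) \<tau>" for \<tau>
        unfolding \<psi>_def upd q(2) by (simp add: poly_pcompose)
      ultimately show ?thesis by blast
    qed
    have bound_\<psi>: "\<bar>\<psi> s\<bar> \<le> real M ^ (k + 1)" if "\<And>j. \<bar>s j\<bar> \<le> h'" for s
      unfolding \<psi>_def by (rule M) (use that in simp)
    have "\<exists>H. (\<forall>x\<in>{v0, 0}. l1_series x \<rho> H (lebesgue_bound k C h' ^ CARD('n) * real M ^ (k + 1))) \<and>
        (\<forall>v. (\<forall>i. \<bar>b i + (\<Sum>j\<in>UNIV. D i j * v $ j)\<bar> \<le> h') \<longrightarrow>
          H v = \<psi> (\<lambda>i. b i + (\<Sum>j\<in>UNIV. D i j * v $ j)))"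
    proof (rule separate_poly_l1_series[OF h' less_imp_le[OF \<rho>]])
      show "\<exists>q. degree q \<le> k \<and> (\<forall>\<tau>. \<bar>\<tau>\<bar> \<le> h' \<longrightarrow> \<psi> (s(i := \<tau>)) = poly q \<tau>)"
        if "\<And>j. \<bar>s j\<bar> \<le> h'" for s i by (rule poly_\<psi>) (rule that)
      show "\<bar>\<psi> s\<bar> \<le> real M ^ (k + 1)" if "\<And>j. \<bar>s j\<bar> \<le> h'" for s by (rule bound_\<psi>) (rule that)
      show "\<bar>b i + (\<Sum>j\<in>UNIV. D i j * x $ j)\<bar> + h' + (\<Sum>j\<in>UNIV. \<bar>D i j\<bar> * \<rho>) \<le> C"
        if "x \<in> {v0, 0}" for x i unfolding S_b by (rule C[OF that])
    qed
    then show ?thesis unfolding S_b \<psi>_def \<Lambda>_def by simp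
  qed
  then have "\<forall>k. \<exists>H. (\<forall>x\<in>{v0, 0}. l1_series x \<rho> H (\<Lambda> k)) \<and>
      (\<forall>v. (\<forall>i. \<bar>S i v - s0 i\<bar> \<le> h') \<longrightarrow> H v = \<phi> k (\<lambda>i. S i v))" by blast
  from choice[OF this] obtain \<Phi> where \<Phi>0: "\<forall>k. (\<forall>x\<in>{v0, 0}. l1_series x \<rho> (\<Phi> k) (\<Lambda> k)) \<and>
      (\<forall>v. (\<forall>i. \<bar>S i v - s0 i\<bar> \<le> h') \<longrightarrow> \<Phi> k v = \<phi> k (\<lambda>i. S i v))" by blast
  have \<Phi>_l1: "l1_series x \<rho> (\<Phi> k) (\<Lambda> k)" if "x \<in> {v0, 0}" for x k using \<Phi>0 that by blast
  have \<Phi>_eq: "\<Phi> k v = \<phi> k (\<lambda>i. S i v)" if "\<And>i. \<bar>S i v - s0 i\<bar> \<le> h'" for v k using \<Phi>0 that by blast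
  \<comment> \<open>The bound of \<open>lebesgue_bound_le\<close>, raised to the power
    \<open>CARD('n)\<close> and multiplied by \<open>real M ^ (k + 1)\<close>, equals
    \<open>B * L ^ k\<close>.\<close>
  define B where "B = 3 ^ CARD('n) * real M"
  define L where "L = (6 * C / h') ^ CARD('n) * real M"
  have L0: "L \<ge> 0" using C0 h' by (simp add: L_def)
  have \<Lambda>_le: "\<Lambda> k \<le> B * L ^ k" for k
  proof -
    have "lebesgue_bound k C h' \<ge> 0"
      unfolding lebesgue_bound_def using C0 by (intro sum_nonneg prod_nonneg) auto
    then have "\<Lambda> k \<le> (3 * (6 * C / h') ^ k) ^ CARD('n) * real M ^ (k + 1)"
      unfolding \<Lambda>_def by (intro mult_right_mono power_mono lebesgue_bound_le C0 h') auto
    also have "\<dots> = B * L ^ k"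
      by (simp add: B_def L_def power_mult_distrib power_add mult_ac flip: power_mult)
    finally show ?thesis .
  qed
  \<comment> \<open>Exceeds the norm of every vector in the box near \<open>v0\<close> and bounds
    the norms along the segments from \<open>v0\<close> to the vectors near 0.\<close>
  define m where "m = norm u1 + d + 2 * norm v0 + 2"
  have m: "m > 0" unfolding m_def using d norm_ge_zero[of u1] norm_ge_zero[of v0] by linarith
  \<comment> \<open>The three terms ensure, in order, that the series \<open>g\<close> converges,
    that the Taylor series along rays converges up to \<open>t\<close>, and that the points
    \<open>a + t *\<^sub>R v\<close> stay in \<open>ball a d\<close>.\<close>
  define t where "t = min (1 / (2 * (L + 1))) (min (1 / (2 * (real M + 1))) (d / (2 * m)))"
  have t: "t > 0" unfolding t_def using L0 m d by simp
  have tL: "t * L \<le> 1 / 2"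
  proof -
    have "t * L \<le> 1 / (2 * (L + 1)) * L" using L0 by (intro mult_right_mono) (auto simp: t_def)
    also have "\<dots> \<le> 1 / 2" using L0 by (simp add: field_simps)
    finally show ?thesis .
  qed
  have tM: "t * real M < 1"
  proof -
    have "t * real M \<le> 1 / (2 * (real M + 1)) * real M" by (intro mult_right_mono) (auto simp: t_def)
    also have "\<dots> < 1" by (simp add: field_simps)
    finally show ?thesis .
  qed
  have tm: "t * m < d"
  proof -
    have "t * m \<le> d / (2 * m) * m" using m by (intro mult_right_mono) (auto simp: t_def)
    also have "\<dots> < d" using m d by simp
    finally show ?thesis .
  qed
  \<comment> \<open>The same \<open>g\<close> is expanded about \<open>v0\<close> and about 0, which
    links the box to the origin.\<close>
  define g where "g v = (\<Sum>k. t ^ k * \<Phi> k v)" for v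
  have g_l1: "l1_series x \<rho> g (\<Sum>k. t ^ k * (B * L ^ k))" if x: "x \<in> {v0, 0}" for x
    unfolding g_def
  proof (rule l1_series_suminf[OF _ _ \<rho>])
    show "l1_series x \<rho> (\<lambda>v. t ^ k * \<Phi> k v) (t ^ k * (B * L ^ k))" for k
      using l1_series_scale[OF l1_series_mono[OF \<Phi>_l1[OF x] \<Lambda>_le], of "t ^ k" k] t by simp
    have "summable (\<lambda>k. B * (t * L) ^ k)"
      using tL t L0 by (intro summable_mult summable_geometric) auto
    then show "summable (\<lambda>k. t ^ k * (B * L ^ k))"
      by (simp add: power_mult_distrib mult_ac)
  qed
  have near: "f (a + t *\<^sub>R v) = g v" if v: "\<And>i. \<bar>S i v - s0 i\<bar> \<le> h'" for v
  proof -
    let ?s = "\<lambda>i. S i v"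
    have s: "\<bar>?s j\<bar> \<le> h" for j using box[of ?s] v by simp
    have v_u1: "v \<in> ball u1 (d / 2)" using T_ball[of ?s, OF s] by (simp add: TS)
    then have "v \<in> ball u1 d" using d by simp
    have norm_v: "norm v < m" using v_u1 norm_triangle_sub[of v u1] norm_ge_zero[of v0] d
      unfolding m_def mem_ball dist_norm norm_minus_commute[of u1 v] by linarith
    \<comment> \<open>The radius in \<open>series\<close> depends on the direction and may be
      smaller than \<open>t\<close>; the identity theorem on \<open>{0..t}\<close> bridges the
      gap.\<close>
    have "f (a + t *\<^sub>R v) = (\<Sum>k. \<phi> k ?s * t ^ k)"
    proof (rule analytic_at1_identity[of t "\<lambda>t. f (a + t *\<^sub>R v)" "\<lambda>t. \<Sum>k. \<phi> k ?s * t ^ k"])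
      fix \<tau> assume \<tau>: "\<tau> \<in> {0..t}"
      have "\<bar>\<tau>\<bar> * norm v \<le> t * m" using \<tau> norm_v t by (intro mult_mono) auto
      then have "a + \<tau> *\<^sub>R (1 *\<^sub>R v) \<in> ball a d" using tm by (simp add: dist_norm)
      from line_analytic_on_planes[OF planes U aU \<open>v \<in> ball u1 d\<close> d this]
      show "analytic_at1 (\<lambda>t. f (a + t *\<^sub>R v)) \<tau>" by simp
      have "\<bar>\<tau>\<bar> * real M \<le> t * real M" using \<tau> by (intro mult_right_mono) auto
      then show "analytic_at1 (\<lambda>t. \<Sum>k. \<phi> k ?s * t ^ k) \<tau>"
        using tM M[of ?s, OF v] by (intro geometric_coeff_analytic_at1[of _ "real M"]) auto
    next
      obtain r where r: "r > 0" "\<And>t. \<bar>t\<bar> < r \<Longrightarrow> (\<lambda>k. \<phi> k ?s * t ^ k) sums f (a + t *\<^sub>R T ?s)"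
        using series[of ?s, OF s] by blast
      have "eventually (\<lambda>t. t \<in> ball 0 r) (nhds (0::real))"
        using r(1) by (intro eventually_nhds_in_open) auto
      then show "eventually (\<lambda>t. f (a + t *\<^sub>R v) = (\<Sum>k. \<phi> k ?s * t ^ k)) (nhds 0)"
        by eventually_elim (use r(2) in \<open>simp add: TS sums_unique\<close>)
    qed (use t in simp)
    also have "\<dots> = g v" unfolding g_def using \<Phi>_eq[of v, OF v] by (simp add: mult.commute)
    finally show ?thesis .
  qed
  \<comment> \<open>the region reached by \<open>near\<close> does not contain \<open>v = 0\<close>; lines from \<open>v0\<close> do reach it\<close>
  have all: "f (a + t *\<^sub>R v) = g v" if v: "norm v < min 1 (d / 2)" for v
  proof -
    let ?x = "\<lambda>\<tau>. v0 + \<tau> *\<^sub>R (v - v0)"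
    \<comment> \<open>The segment runs along \<open>v - v0\<close>, which is near
      \<open>- u1\<close>; the sign and the factor \<open>t\<close> are absorbed by the scalar in
      \<open>line_analytic_on_planes\<close>.\<close>
    have dir: "v0 - v \<in> ball u1 d"
    proof -
      have "norm (u1 - (v0 - v)) \<le> norm (u1 - v0) + norm v"
        using norm_triangle_ineq[of "u1 - v0" v] by (simp add: algebra_simps)
      then show ?thesis using v v0 by (simp add: dist_norm)
    qed
    have norm_dir: "norm (v - v0) \<le> norm v0 + 1" using v norm_triangle_ineq4[of v v0] by linarith
    have x_ball: "a + t *\<^sub>R ?x \<tau> \<in> ball a d" if \<tau>: "\<tau> \<in> {0..1}" for \<tau>
    proof -
      have "norm (?x \<tau>) \<le> norm v0 + \<bar>\<tau>\<bar> * norm (v - v0)"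
        using norm_triangle_ineq[of v0 "\<tau> *\<^sub>R (v - v0)"] by simp
      also have "\<dots> \<le> norm v0 + 1 * (norm v0 + 1)"
        using \<tau> norm_dir by (intro add_left_mono mult_mono) auto
      also have "\<dots> \<le> m" unfolding m_def using d by simp
      finally have "t * norm (?x \<tau>) \<le> t * m" using t by (intro mult_left_mono) auto
      then have "t * norm (?x \<tau>) < d" using tm by linarith
      then show ?thesis using t by (simp add: dist_norm)
    qed
    have "f (a + t *\<^sub>R ?x 1) = g (?x 1)"
    proof (rule analytic_at1_identity[of 1 "\<lambda>\<tau>. f (a + t *\<^sub>R ?x \<tau>)" "\<lambda>\<tau>. g (?x \<tau>)"])
      fix \<tau> :: real assume \<tau>: "\<tau> \<in> {0..1}"
      have eq: "a + t *\<^sub>R ?x \<tau>' = (a + t *\<^sub>R v0) + \<tau>' *\<^sub>R ((- t) *\<^sub>R (v0 - v))" for \<tau>'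
        by (simp add: algebra_simps)
      have "a + t *\<^sub>R v0 \<in> ball a d" using x_ball[of 0] by simp
      from line_analytic_on_planes[OF planes U this dir d x_ball[OF \<tau>, unfolded eq]]
      show "analytic_at1 (\<lambda>\<tau>. f (a + t *\<^sub>R ?x \<tau>)) \<tau>" unfolding eq .
      \<comment> \<open>The parameter radius 2 about the centre \<open>v0\<close> covers
        \<open>{0..1}\<close> with room to spare.\<close>
      have "2 * \<bar>(v - v0) $ i\<bar> \<le> \<rho>" for i
        using component_le_norm_cart[of "v - v0" i] norm_dir unfolding \<rho>_def by linarith
      then show "analytic_at1 (\<lambda>\<tau>. g (?x \<tau>)) \<tau>"
        using \<tau> by (intro l1_series_line_analytic[OF g_l1, of _ 2]) auto
    next
      \<comment> \<open>The segment starts at the centre of the box, so \<open>near\<close> applies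
        for all small \<tau>.\<close>
      have "eventually (\<lambda>\<tau>. \<bar>S i (?x \<tau>) - s0 i\<bar> < h') (nhds 0)" for i
      proof -
        have eq: "S i (?x \<tau>) - s0 i = \<tau> * (\<Sum>j\<in>UNIV. D i j * (v - v0) $ j)" for \<tau>
        proof -
          have "S i (?x \<tau>) = S i v0 + \<tau> * (\<Sum>j\<in>UNIV. D i j * (v - v0) $ j)"
            unfolding S_def by (simp add: sum_distrib_left sum.distrib[symmetric] algebra_simps)
          then show ?thesis by (simp add: S_v0)
        qed
        have "((\<lambda>\<tau>. \<bar>\<tau> * (\<Sum>j\<in>UNIV. D i j * (v - v0) $ j)\<bar>) \<longlongrightarrow> \<bar>0 * (\<Sum>j\<in>UNIV. D i j * (v - v0) $ j)\<bar>) (nhds 0)"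
          by (intro tendsto_intros filterlim_ident)
        then show ?thesis unfolding eq using h' by (intro order_tendstoD(2)) auto
      qed
      then have "eventually (\<lambda>\<tau>. \<forall>i. \<bar>S i (?x \<tau>) - s0 i\<bar> < h') (nhds 0)"
        by (rule eventually_all_finite)
      then show "eventually (\<lambda>\<tau>. f (a + t *\<^sub>R ?x \<tau>) = g (?x \<tau>)) (nhds 0)"
        by eventually_elim (rule near, simp add: less_imp_le)
    qed simp
    then show ?thesis by simp
  qed
  show ?thesis
    by (rule l1_series_real_analytic_at[where e = "min 1 (d / 2)", OF g_l1 \<rho> t _ all]) (use d in simp_all)
qed

subsection \<open>Perturbed planes\<close>

text \<open>Each coefficient is an inner product with a unit vector, so Cauchy-Schwarz
  applies.\<close>

lemma orthonormal_coeff_le: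
  fixes u1 u2 :: "'a::real_inner"
  assumes "norm u1 = 1" "norm u2 = 1" "u1 \<bullet> u2 = 0"
  shows "\<bar>\<alpha>\<bar> + \<bar>\<beta>\<bar> \<le> 2 * norm (\<alpha> *\<^sub>R u1 + \<beta> *\<^sub>R u2)"
proof -
  let ?x = "\<alpha> *\<^sub>R u1 + \<beta> *\<^sub>R u2"
  have "?x \<bullet> u1 = \<alpha>" "?x \<bullet> u2 = \<beta>"
    using assms by (simp_all add: inner_add_left inner_commute[of u2 u1] dot_square_norm)
  then have "\<bar>\<alpha>\<bar> \<le> norm ?x * norm u1" "\<bar>\<beta>\<bar> \<le> norm ?x * norm u2"
    using Cauchy_Schwarz_ineq2[of ?x u1] Cauchy_Schwarz_ineq2[of ?x u2] by simp_all
  then show ?thesis using assms by simp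
qed

lemma aff_dim_plane:
  fixes v w :: "'a::euclidean_space"
  assumes ind: "\<And>\<alpha> \<beta>. \<alpha> *\<^sub>R v + \<beta> *\<^sub>R w = 0 \<Longrightarrow> \<alpha> = 0 \<and> \<beta> = 0"
  shows "aff_dim ((+) y ` span {v, w}) = 2"
proof -
  have w: "w \<noteq> 0" using ind[of 0 1] by auto
  have "v \<notin> span {w}"
  proof
    assume "v \<in> span {w}"
    then obtain k where "v = k *\<^sub>R w" by (auto simp: span_singleton)
    then show False using ind[of 1 "- k"] by simp
  qed
  moreover from this have "v \<noteq> w" by (auto simp: span_base)
  ultimately have "independent {v, w}" "card {v, w} = 2" using w by (auto simp: independent_insert)
  then have "dim (span {v, w}) = 2" by (simp add: dim_eq_card_independent)
  then show ?thesis by (simp add: aff_dim_translation_eq aff_dim_subspace)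
qed

text \<open>A perturbed plane deviates from \<open>Q\<close> by an error of size \<open>d\<close>
  times a constant plus the distance from \<open>p\<close>, up to factors. Near \<open>p\<close> the
  ball absorbs it. Far away the relative error is small, and after scaling to the unit sphere of
  \<open>W\<close> compactness gives a uniform margin inside the cone.\<close>

lemma holds_near_perturbed_planes:
  fixes Q :: "'a::euclidean_space set"
  assumes Q: "affine Q" "aff_dim Q = 2" and near: "holds_near Q P" and a: "a \<in> Q"
  obtains d u1 u2 where "d > 0"
    "\<forall>y\<in>ball a d. \<forall>v\<in>ball u1 d. \<forall>w\<in>ball u2 d. P ((+) y ` span {v, w})"
proof -
  obtain p C \<epsilon> where p: "p \<in> Q" and \<epsilon>: "\<epsilon> > 0" and cone: "open_cone ((\<lambda>x. x - p) ` C)" and QC: "Q \<subseteq> C"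
    and P: "\<forall>Q'. affine Q' \<and> aff_dim Q' = aff_dim Q \<and> Q' \<subseteq> C \<union> ball p \<epsilon> \<longrightarrow> P Q'"
    using near unfolding holds_near_def by blast
  define W where "W = (\<lambda>x. x - a) ` Q"
  have W: "subspace W" unfolding W_def by (rule affine_diffs_subspace_subtract[OF Q(1) a])
  have dimW: "dim W = 2"
    using aff_dim_eq_dim_subtract[of a Q] a Q(2) by (simp add: W_def hull_inc)
  obtain B where B: "B \<subseteq> W" "pairwise orthogonal B" "\<And>x. x \<in> B \<Longrightarrow> norm x = 1"
      "independent B" "card B = dim W" "span B = W"
    using orthonormal_basis_subspace[OF W] by metis
  obtain u1 u2 where u: "B = {u1, u2}" "u1 \<noteq> u2" using B(5) dimW by (auto simp: card_2_iff)
  have orth: "norm u1 = 1" "norm u2 = 1" "u1 \<bullet> u2 = 0"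
    using B(2,3) u by (auto simp: pairwise_def orthogonal_def)
  have uW: "u1 \<in> W" "u2 \<in> W" using B(1) u by auto
  \<comment> \<open>As \<open>a\<close> and \<open>p\<close> both lie in \<open>Q\<close>, the
    direction space \<open>W\<close> is also \<open>Q\<close> translated by \<open>- p\<close>,
    hence lies in the cone.\<close>
  have pW: "a - p \<in> W" using p subspace_neg[OF W, of "p - a"] by (auto simp: W_def)
  define CC where "CC = (\<lambda>x. x - p) ` C"
  have WC: "W \<subseteq> CC"
  proof
    fix z assume z: "z \<in> W"
    have "z - (a - p) \<in> W" by (rule subspace_diff[OF W z pW])
    then obtain q where "q \<in> Q" "z - (a - p) = q - a" by (auto simp: W_def)
    then have "q \<in> C" "z = q - p" using QC by (auto simp: algebra_simps)
    then show "z \<in> CC" unfolding CC_def by blast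
  qed
  have CC_cone: "t *\<^sub>R x \<in> CC" if "x \<in> CC" for t x
    using cone that unfolding open_cone_def real_cone_def CC_def by blast
  have "open (CC - {0})"
  proof -
    have "openin (top_of_set (UNIV - {0})) (CC - {0})" using cone by (simp add: open_cone_def CC_def)
    then show ?thesis by (rule openin_open_trans) (simp add: open_delete)
  qed
  moreover have "compact (W \<inter> sphere 0 1)"
    using closed_subspace[OF W] by (rule closed_Int_compact) simp
  moreover have "W \<inter> sphere 0 1 \<subseteq> CC - {0}" using WC by auto
  ultimately obtain \<delta> where \<delta>: "\<delta> > 0" "(\<Union>x\<in>W \<inter> sphere 0 1. ball x \<delta>) \<subseteq> CC - {0}"
    by (metis compact_subset_open_imp_ball_epsilon_subset)
  define Z where "Z = 1 + 2 * norm (a - p)"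
  have Z: "Z > 0" unfolding Z_def using norm_ge_zero[of "a - p"] by linarith
  \<comment> \<open>The bound 1/4 keeps \<open>v\<close> and \<open>w\<close> independent, the
    second keeps distant points in the cone, the third keeps points close to \<open>p\<close> in the
    ball.\<close>
  define d where "d = min (1 / 4) (min (\<delta> / (2 * (2 * Z / \<epsilon> + 2))) (\<epsilon> / (2 * (Z + \<epsilon>))))"
  have d: "d > 0" using \<delta>(1) Z \<epsilon> by (simp add: d_def add_pos_pos)
  have d1: "d \<le> 1 / 4" unfolding d_def by (rule min.cobounded1)
  have d2: "d * (2 * Z / \<epsilon> + 2) < \<delta>"
  proof -
    have pos: "2 * Z / \<epsilon> + 2 > 0" using Z \<epsilon> by (simp add: add_pos_pos)
    have "d * (2 * Z / \<epsilon> + 2) \<le> \<delta> / (2 * (2 * Z / \<epsilon> + 2)) * (2 * Z / \<epsilon> + 2)"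
      using pos by (intro mult_right_mono) (auto simp: d_def)
    also have "\<dots> = \<delta> / 2"
    proof -
      have "\<delta> / (2 * q) * q = \<delta> / 2" if "q > 0" for q using that by simp
      from this[OF pos] show ?thesis .
    qed
    finally have "d * (2 * Z / \<epsilon> + 2) \<le> \<delta> / 2" .
    also have "\<dots> < \<delta>" using \<delta>(1) by simp
    finally show ?thesis .
  qed
  have d3: "d * (Z + \<epsilon>) \<le> \<epsilon> / 2"
  proof -
    have "d * (Z + \<epsilon>) \<le> \<epsilon> / (2 * (Z + \<epsilon>)) * (Z + \<epsilon>)"
      using Z \<epsilon> by (intro mult_right_mono) (auto simp: d_def)
    also have "\<dots> = \<epsilon> / 2"
    proof -
      have "\<epsilon> / (2 * q) * q = \<epsilon> / 2" if "q > 0" for q using that by simp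
      from this[of "Z + \<epsilon>"] Z \<epsilon> show ?thesis by simp
    qed
    finally show ?thesis .
  qed
  have "P ((+) y ` span {v, w})" if y: "y \<in> ball a d" and v: "v \<in> ball u1 d" and w: "w \<in> ball u2 d" for y v w
  proof -
    have err: "norm (\<alpha> *\<^sub>R (v - u1) + \<beta> *\<^sub>R (w - u2)) \<le> d * (\<bar>\<alpha>\<bar> + \<bar>\<beta>\<bar>)" for \<alpha> \<beta>
    proof -
      have "norm (\<alpha> *\<^sub>R (v - u1) + \<beta> *\<^sub>R (w - u2)) \<le> \<bar>\<alpha>\<bar> * norm (v - u1) + \<bar>\<beta>\<bar> * norm (w - u2)"
        using norm_triangle_ineq[of "\<alpha> *\<^sub>R (v - u1)" "\<beta> *\<^sub>R (w - u2)"] by simp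
      also have "\<dots> \<le> \<bar>\<alpha>\<bar> * d + \<bar>\<beta>\<bar> * d"
        using v w by (intro add_mono mult_left_mono) (auto simp: dist_norm norm_minus_commute)
      finally show ?thesis by (simp add: algebra_simps)
    qed
    have "\<alpha> = 0 \<and> \<beta> = 0" if eq: "\<alpha> *\<^sub>R v + \<beta> *\<^sub>R w = 0" for \<alpha> \<beta>
    proof -
      have "\<alpha> *\<^sub>R (v - u1) + \<beta> *\<^sub>R (w - u2) = - (\<alpha> *\<^sub>R u1 + \<beta> *\<^sub>R u2)"
        using eq by (simp add: algebra_simps add_eq_0_iff)
      then have "norm (\<alpha> *\<^sub>R u1 + \<beta> *\<^sub>R u2) \<le> d * (\<bar>\<alpha>\<bar> + \<bar>\<beta>\<bar>)" using err[of \<alpha> \<beta>]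
        by (simp only: norm_minus_cancel)
      also have "\<dots> \<le> 1 / 4 * (\<bar>\<alpha>\<bar> + \<bar>\<beta>\<bar>)" using d1 by (intro mult_right_mono) auto
      finally have "4 * norm (\<alpha> *\<^sub>R u1 + \<beta> *\<^sub>R u2) \<le> \<bar>\<alpha>\<bar> + \<bar>\<beta>\<bar>" by simp
      then have "\<bar>\<alpha>\<bar> + \<bar>\<beta>\<bar> \<le> 0" using orthonormal_coeff_le[OF orth, of \<alpha> \<beta>] by linarith
      then have "\<bar>\<alpha>\<bar> \<le> 0" "\<bar>\<beta>\<bar> \<le> 0" by linarith+
      then show ?thesis by simp
    qed
    then have dim: "aff_dim ((+) y ` span {v, w}) = 2" by (rule aff_dim_plane)
    have "(+) y ` span {v, w} \<subseteq> C \<union> ball p \<epsilon>"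
    proof
      fix x assume "x \<in> (+) y ` span {v, w}"
      then obtain \<alpha> \<beta> where x: "x = y + (\<alpha> *\<^sub>R v + \<beta> *\<^sub>R w)"
        by (auto simp: span_insert span_singleton algebra_simps)
      \<comment> \<open>\<open>z\<close> is the corresponding point of the unperturbed plane
        relative to \<open>p\<close>, and \<open>e\<close> is the error.\<close>
      define z where "z = (a - p) + (\<alpha> *\<^sub>R u1 + \<beta> *\<^sub>R u2)"
      define e where "e = (y - a) + (\<alpha> *\<^sub>R (v - u1) + \<beta> *\<^sub>R (w - u2))"
      have xpz: "x - p = z + e" by (simp add: x z_def e_def algebra_simps)
      have zW: "z \<in> W" unfolding z_def by (intro subspace_add[OF W] subspace_scale[OF W] pW uW)
      have "norm (\<alpha> *\<^sub>R u1 + \<beta> *\<^sub>R u2) \<le> norm z + norm (a - p)"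
        using norm_triangle_ineq4[of z "a - p"] by (simp add: z_def)
      then have "\<bar>\<alpha>\<bar> + \<bar>\<beta>\<bar> \<le> 2 * norm z + 2 * norm (a - p)"
        using orthonormal_coeff_le[OF orth, of \<alpha> \<beta>] by linarith
      then have "d * (\<bar>\<alpha>\<bar> + \<bar>\<beta>\<bar>) \<le> d * (2 * norm z + 2 * norm (a - p))" using d by (intro mult_left_mono) auto
      moreover have "norm e \<le> norm (y - a) + norm (\<alpha> *\<^sub>R (v - u1) + \<beta> *\<^sub>R (w - u2))"
        unfolding e_def by (rule norm_triangle_ineq)
      moreover have "norm (y - a) \<le> d" using y by (simp add: dist_norm norm_minus_commute)
      ultimately have "norm e \<le> d + d * (2 * norm z + 2 * norm (a - p))" using err[of \<alpha> \<beta>] by linarith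
      then have e: "norm e \<le> d * (Z + 2 * norm z)" by (simp add: Z_def algebra_simps)
      show "x \<in> C \<union> ball p \<epsilon>"
      proof (cases "norm z < \<epsilon> / 2")
        case True
        then have "d * (Z + 2 * norm z) \<le> d * (Z + \<epsilon>)" using d by (intro mult_left_mono) auto
        then have "norm (x - p) < \<epsilon>"
          using True e d3 norm_triangle_ineq[of z e] unfolding xpz by linarith
        then show ?thesis by (simp add: dist_norm norm_minus_commute)
      next
        case False
        then have nz: "norm z > 0" and nz': "\<epsilon> / 2 \<le> norm z" using \<epsilon> by auto
        let ?z = "(1 / norm z) *\<^sub>R z"
        have "norm ((1 / norm z) *\<^sub>R e) = norm e / norm z" by simp
        also have "\<dots> \<le> d * (Z + 2 * norm z) / norm z" using e nz by (simp add: divide_right_mono)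
        also have "\<dots> = d * (Z / norm z + 2)" using nz by (simp add: field_simps)
        also have "\<dots> \<le> d * (Z / (\<epsilon> / 2) + 2)"
          using nz nz' d Z \<epsilon> by (intro mult_left_mono add_right_mono divide_left_mono) auto
        also have "\<dots> < \<delta>" using d2 by (simp add: mult.commute)
        finally have "?z + (1 / norm z) *\<^sub>R e \<in> ball ?z \<delta>" by (simp add: dist_norm)
        moreover have "?z \<in> W \<inter> sphere 0 1" using nz by (simp add: subspace_scale[OF W zW])
        ultimately have "?z + (1 / norm z) *\<^sub>R e \<in> CC" using \<delta>(2) by blast
        from CC_cone[OF this, of "norm z"] have "x - p \<in> CC" using nz by (simp add: xpz scaleR_add_right)
        then show ?thesis by (auto simp: CC_def)
      qed
    qed
    moreover have "affine ((+) y ` span {v, w})"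
      by (simp add: affine_translation[symmetric] subspace_imp_affine)
    ultimately show ?thesis using P dim Q(2) by simp
  qed
  then show thesis by (intro that[OF d, of u1 u2]) blast
qed

theorem theorem7:
  fixes U Q :: "(real ^ 'n) set"
    and f :: "real ^ 'n \<Rightarrow> real"
  assumes "open U"
    and "affine Q" and "aff_dim Q = 2"
    and "holds_near Q (\<lambda>Q'. real_analytic_on_plane f Q' U)"
  shows "\<exists>V. open V \<and> Q \<inter> U \<subseteq> V \<and> V \<subseteq> U \<and> real_analytic_on f V"
proof (intro exI conjI)
  \<comment> \<open>With this choice it suffices to find a ball of analytic points about each point
    of \<open>Q \<inter> U\<close>.\<close>
  let ?V = "interior {x \<in> U. real_analytic_at f x}"
  show "open ?V" by simp
  show "?V \<subseteq> U" "real_analytic_on f ?V"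
    using interior_subset[of "{x \<in> U. real_analytic_at f x}"] by (auto simp: real_analytic_on_def)
  show "Q \<inter> U \<subseteq> ?V"
  proof
    fix a assume a: "a \<in> Q \<inter> U"
    obtain d u1 u2 where d: "d > 0" and planes: "\<forall>y\<in>ball a d. \<forall>v\<in>ball u1 d. \<forall>w\<in>ball u2 d.
        real_analytic_on_plane f ((+) y ` span {v, w}) U"
      by (rule holds_near_perturbed_planes[OF assms(2-4), of a]) (use a in auto)
    obtain r where r: "r > 0" "ball a r \<subseteq> U" using assms(1) a by (auto simp: open_contains_ball)
    \<comment> \<open>Halving makes the hypotheses at \<open>a\<close> available on the ball of
      radius \<open>h\<close> about every \<open>x\<close> in \<open>ball a h\<close>.\<close>
    define h where "h = min d r / 2"
    have h: "h > 0" "2 * h \<le> d" "2 * h \<le> r" using d r by (auto simp: h_def)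
    have "real_analytic_at f x" if x: "x \<in> ball a h" for x
    proof (rule real_analytic_at_if_planes[OF h(1), of x U u1 u2])
      have sub: "ball x h \<subseteq> ball a (2 * h)"
      proof
        fix z assume "z \<in> ball x h"
        then show "z \<in> ball a (2 * h)" using x dist_triangle[of a z x] by simp
      qed
      moreover have "ball a (2 * h) \<subseteq> ball a r" using h by auto
      ultimately show "ball x h \<subseteq> U" using r(2) by blast
      fix y v w assume "y \<in> ball x h" "v \<in> ball u1 h" "w \<in> ball u2 h"
      moreover have "ball x h \<subseteq> ball a d" using sub h by auto
      ultimately show "real_analytic_on_plane f ((+) y ` span {v, w}) U"
        using planes h by (auto simp: subset_iff)
    qed
    moreover have "ball a h \<subseteq> U" using r(2) h by auto
    ultimately show "a \<in> ?V" unfolding mem_interior using h(1) by blast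
  qed
qed

end
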